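(* Let $M:[0,\infty)\to[0,\infty)$ be a differentiable $N$-function and let $D_M\ge d_M\ge 1$ be constants with $d_M\frac{M(\lambda)}{\lambda}\le M'(\lambda)\le D_M\frac{M(\lambda)}{\lambda}$ for every $\lambda>0$. Let $\varphi\in C^2(\mathbb{R}_+)$ be such that $\varphi'$ never vanishes, and let $\mu(dr)=e^{-\varphi(r)}dr$ on $\mathbb{R}_+$. Put $c(r)=\max(r^{d_M},r^{D_M})$. Assume that either $$\text{(a)}\quad \sup_{r>0}\frac{\varphi''(r)}{(\varphi'(r))^2}<\frac{1}{D_M-1},\qquad\text{or}\qquad\text{(b)}\quad\inf_{r>0}\frac{\varphi''(r)}{(\varphi'(r))^2}>\frac{1}{d_M-1}.$$ Then the inequalities $$\int_{\mathbb{R}_+}M(|\varphi'(r)||u(r)|)e^{-\varphi(r)}dr\le C\int_{\mathbb{R}_+}M(|u'(r)|)e^{-\varphi(r)}dr,$$ $$\|\varphi'u\|_{L^M_\mu}\le\tilde{C}\,\|u'\|_{L^M_\mu}$$ hold for every $u\in\mathcal{R}^+_{(|\varphi'|,\varphi,M)}$ with $C=c\left(\frac{D_M^2}{b_1d_M}\right)$, $\tilde{C}=c\left(\frac{D_M^2}{b_1d_M}\right)+1$ in case (a), and for every $u\in\mathcal{R}^-_{(|\varphi'|,\varphi,M)}$ with $C=c\left(\frac{D_M^2}{b_2d_M}\right)$, $\tilde{C}=c\left(\frac{D_M^2}{b_2d_M}\right)+1$ in case (b).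
   Context: $\mathbb{R}_+=(0,\infty)$. Functions in $W^{1,1}_{loc}(\mathbb{R}_+)$ are identified with their locally absolutely continuous representatives. An $N$-function is a continuous convex function $M:[0,\infty)\to[0,\infty)$ with $M(\lambda)/\lambda\to0$ as $\lambda\to0$ and $M(\lambda)/\lambda\to\infty$ as $\lambda\to\infty$. The Luxemburg norm is $\|f\|_{L^M_\mu}=\inf\{K>0:\int_{\mathbb{R}_+}M(|f(x)|/K)\,d\mu(x)\le1\}$, with $\inf\emptyset=+\infty$. In (b), $\frac1{d_M-1}$ is read as $+\infty$ if $d_M=1$. The constants are $b_1=\inf_{r>0}b_1(r)$ and $b_2=\inf_{r>0}b_2(r)$, where $$b_1(r)=\begin{cases}1+(1-d_M)\frac{\varphi''(r)}{(\varphi'(r))^2}&\text{if }\varphi''(r)\le0,\\ 1+(1-D_M)\frac{\varphi''(r)}{(\varphi'(r))^2}&\text{if }\varphi''(r)\ge0,\end{cases}\qquad b_2(r)=\begin{cases}-1+(D_M-1)\frac{\varphi''(r)}{(\varphi'(r))^2}&\text{if }\varphi''(r)\le0,\\ -1+(d_M-1)\frac{\varphi''(r)}{(\varphi'(r))^2}&\text{if }\varphi''(r)\ge0.\end{cases}$$ For $u\in W^{1,1}_{loc}(\mathbb{R}_+)$ set $h^u(r)=\frac{1}{\varphi'(r)}M(|\varphi'(r)||u(r)|)$. Then $\mathcal{R}^+_{(|\varphi'|,\varphi,M)}$ (respectively $\mathcal{R}^-_{(|\varphi'|,\varphi,M)}$) is the set of $u\in W^{1,1}_{loc}(\mathbb{R}_+)$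 for which there exist sequences $s_n\to0$, $R_n\to\infty$ such that $\lim_{n\to\infty}\left(h^u(R_n)e^{-\varphi(R_n)}-h^u(s_n)e^{-\varphi(s_n)}\right)$ exists in $[-\infty,\infty]$ and is $\ge0$ (respectively $\le0$). *)

theory Defs
  imports "HOL-Analysis.Analysis"
begin

text \<open>Functions on the half-line \<open>(0, \<infinity>)\<close> or on \<open>[0, \<infinity>)\<close> are total functions on the reals;
  their values outside the respective half-line never matter.\<close>

definition N_function :: "(real \<Rightarrow> real) \<Rightarrow> bool" where
  "N_function M \<longleftrightarrow>
     (\<forall>x\<ge>0. 0 \<le> M x) \<and> continuous_on {0..} M \<and> convex_on {0..} M \<and>
     ((\<lambda>x. M x / x) \<longlongrightarrow> 0) (at_right 0) \<and>
     filterlim (\<lambda>x. M x / x) at_top at_top"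

definition luxemburg_norm :: "(real \<Rightarrow> real) \<Rightarrow> 'a measure \<Rightarrow> ('a \<Rightarrow> real) \<Rightarrow> ennreal" where
  "luxemburg_norm M \<mu> f =
     Inf {ennreal K | K. K > 0 \<and> (\<integral>\<^sup>+x. ennreal (M (\<bar>f x\<bar> / K)) \<partial>\<mu>) \<le> 1}"

definition weight_measure :: "(real \<Rightarrow> real) \<Rightarrow> real measure" where
  "weight_measure \<phi> = density (lebesgue_on {0<..}) (\<lambda>r. ennreal (exp (- \<phi> r)))"


text \<open>The space $C_c^\infty(0,\infty)$, each function being extended by 0 to the whole line.\<close>

definition test_function :: "(real \<Rightarrow> real) \<Rightarrow> bool" where
  "test_function \<psi> \<longleftrightarrow>
     (\<forall>n x. (deriv ^^ n) \<psi> differentiable (at x)) \<and>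
     compact (closure {x. \<psi> x \<noteq> 0}) \<and> closure {x. \<psi> x \<noteq> 0} \<subseteq> {0<..}"

definition locally_integrable :: "(real \<Rightarrow> real) \<Rightarrow> bool" where
  "locally_integrable f \<longleftrightarrow>
     (\<forall>K. compact K \<and> K \<subseteq> {0<..} \<longrightarrow> f absolutely_integrable_on K)"

definition weak_derivative :: "(real \<Rightarrow> real) \<Rightarrow> (real \<Rightarrow> real) \<Rightarrow> bool" where
  "weak_derivative u v \<longleftrightarrow>
     locally_integrable u \<and> locally_integrable v \<and>
     (\<forall>\<psi>. test_function \<psi> \<longrightarrow>
        (LINT r|lebesgue_on {0<..}. u r * deriv \<psi> r) =
        - (LINT r|lebesgue_on {0<..}. v r * \<psi> r))"

definition locally_absolutely_continuous :: "(real \<Rightarrow> real) \<Rightarrow> bool" where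
  "locally_absolutely_continuous u \<longleftrightarrow>
     (\<forall>a b. 0 < a \<and> a \<le> b \<longrightarrow>
       (\<forall>\<epsilon>>0. \<exists>\<delta>>0. \<forall>(n::nat) x y.
          (\<forall>i<n. a \<le> x i \<and> x i \<le> y i \<and> y i \<le> b) \<and>
          disjoint_family_on (\<lambda>i. {x i<..<y i}) {..<n} \<and>
          (\<Sum>i<n. y i - x i) < \<delta> \<longrightarrow>
          (\<Sum>i<n. \<bar>u (y i) - u (x i)\<bar>) < \<epsilon>))"

text \<open>The space $W^{1,1}_{loc}(0,\infty)$, each class being represented by its locally absolutely
  continuous member. The weak derivative is determined almost everywhere.\<close>

definition W11_loc :: "(real \<Rightarrow> real) set" where
  "W11_loc = {u. locally_absolutely_continuous u \<and> (\<exists>v. weak_derivative u v)}"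


definition h :: "(real \<Rightarrow> real) \<Rightarrow> (real \<Rightarrow> real) \<Rightarrow> (real \<Rightarrow> real) \<Rightarrow> real \<Rightarrow> real" where
  "h \<phi> M u r = 1 / deriv \<phi> r * M (\<bar>deriv \<phi> r\<bar> * \<bar>u r\<bar>)"

definition boundary_limit ::
  "(real \<Rightarrow> real) \<Rightarrow> (real \<Rightarrow> real) \<Rightarrow> (real \<Rightarrow> real) \<Rightarrow> ereal \<Rightarrow> bool" where
  "boundary_limit \<phi> M u L \<longleftrightarrow>
     (\<exists>s R :: nat \<Rightarrow> real. (\<forall>n. 0 < s n \<and> 0 < R n) \<and>
        s \<longlonglongrightarrow> 0 \<and> filterlim R at_top sequentially \<and>
        (\<lambda>n. ereal (h \<phi> M u (R n) * exp (- \<phi> (R n)) - h \<phi> M u (s n) * exp (- \<phi> (s n))))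
          \<longlonglongrightarrow> L)"

definition R_plus :: "(real \<Rightarrow> real) \<Rightarrow> (real \<Rightarrow> real) \<Rightarrow> (real \<Rightarrow> real) set" where
  "R_plus \<phi> M = {u \<in> W11_loc. \<exists>L\<ge>0. boundary_limit \<phi> M u L}"

definition R_minus :: "(real \<Rightarrow> real) \<Rightarrow> (real \<Rightarrow> real) \<Rightarrow> (real \<Rightarrow> real) set" where
  "R_minus \<phi> M = {u \<in> W11_loc. \<exists>L\<le>0. boundary_limit \<phi> M u L}"


definition curvature_ratio :: "(real \<Rightarrow> real) \<Rightarrow> real \<Rightarrow> real" where
  "curvature_ratio \<phi> r = deriv (deriv \<phi>) r / (deriv \<phi> r)\<^sup>2"

definition b1_at :: "(real \<Rightarrow> real) \<Rightarrow> real \<Rightarrow> real \<Rightarrow> real \<Rightarrow> real" where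
  "b1_at \<phi> d D r =
     (if deriv (deriv \<phi>) r \<le> 0 then 1 + (1 - d) * curvature_ratio \<phi> r
      else 1 + (1 - D) * curvature_ratio \<phi> r)"

definition b2_at :: "(real \<Rightarrow> real) \<Rightarrow> real \<Rightarrow> real \<Rightarrow> real \<Rightarrow> real" where
  "b2_at \<phi> d D r =
     (if deriv (deriv \<phi>) r \<le> 0 then - 1 + (D - 1) * curvature_ratio \<phi> r
      else - 1 + (d - 1) * curvature_ratio \<phi> r)"

text \<open>The infima are real ones: \<^term>\<open>b1_at \<phi> d D\<close> is bounded below on \<open>(0, \<infinity>)\<close> if
  \<open>curvature_ratio \<phi> < 1 / (D - 1)\<close> there, and \<^term>\<open>b2_at \<phi> d D\<close> is so if
  \<open>curvature_ratio \<phi> > 1 / (d - 1)\<close> (with \<open>1 \<le> d \<le> D\<close>), which are the only cases in which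
  they are used.\<close>

definition b1 :: "(real \<Rightarrow> real) \<Rightarrow> real \<Rightarrow> real \<Rightarrow> real" where
  "b1 \<phi> d D = (INF r\<in>{0<..}. b1_at \<phi> d D r)"

definition b2 :: "(real \<Rightarrow> real) \<Rightarrow> real \<Rightarrow> real \<Rightarrow> real" where
  "b2 \<phi> d D = (INF r\<in>{0<..}. b2_at \<phi> d D r)"

definition c :: "real \<Rightarrow> real \<Rightarrow> real \<Rightarrow> real" where
  "c d D r = max (r powr d) (r powr D)"

end

theory Submission
  imports Defs
begin

text \<open>Write \<open>\<Phi> t = M \<bar>t\<bar>\<close>, \<open>z = \<phi>' u\<close>, \<open>\<kappa> = \<phi>'' / \<phi>'\<^sup>2\<close>, and let \<open>\<sigma>\<close> be \<open>1\<close> in case (a) and \<open>- 1\<close> in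
  case (b). Everything rests on the flux \<open>F = \<sigma> e\<^bsup>-\<phi>\<^esup> \<Phi>(z) / \<phi>'\<close>, which is the boundary term
  \<open>h e\<^bsup>-\<phi>\<^esup>\<close> up to sign. Its derivative is
  \<open>F' = e\<^bsup>-\<phi>\<^esup> (\<sigma> \<Phi>'(z) u' - \<sigma> (\<Phi>(z) - \<kappa> (z \<Phi>'(z) - \<Phi>(z))))\<close>.
  The growth condition places \<open>z \<Phi>'(z)\<close> between \<open>d \<Phi>(z)\<close> and \<open>D \<Phi>(z)\<close>, so the term
  \<open>\<sigma> (\<Phi>(z) - \<kappa> (z \<Phi>'(z) - \<Phi>(z)))\<close> is at least \<open>b \<Phi>(z)\<close>, where \<open>b > 0\<close> is the constant \<open>b1\<close> or \<open>b2\<close>. Young's inequality in the form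
  \<open>\<bar>\<Phi>'(z)\<bar> \<bar>u'\<bar> \<le> \<epsilon> (\<Phi>(u' / \<epsilon>) + (D - 1) \<Phi>(z))\<close> with \<open>\<epsilon> = b / D\<close> then gives, on every compact
  interval, \<open>\<integral> \<Phi>(z) e\<^bsup>-\<phi>\<^esup> \<le> \<integral> \<Phi>(u' D / b) e\<^bsup>-\<phi>\<^esup> - (D / b) [F]\<close> (lemma \<open>energy_bound_Icc\<close>). Along the
  sequences of the boundary condition the increment \<open>[F]\<close> has a nonnegative limit, and the modular
  inequality follows, even with \<open>D / b\<close> in place of \<open>D\<^sup>2 / (b d)\<close> (lemma \<open>energy_hardy\<close>).

  For the norm inequality the estimate has to be applied to the multiples \<open>k u\<close>. The boundary
  condition compares two boundary terms, one at \<open>0\<close> and one at \<open>\<infinity>\<close>, and is not visibly stable under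
  scaling. However, if both energies are finite, then \<open>F\<close> tends to \<open>0\<close> at infinity (lemma
  \<open>flux_tendsto_0\<close>). What remains is a condition at \<open>0\<close> on a function of constant sign, and such
  a condition is inherited by the multiples, because \<open>\<Phi>(k t) \<le> c(k) \<Phi>(t)\<close> (lemma
  \<open>admissible_scale\<close>).

  Near infinity \<open>F\<close> is almost decreasing, because its increments are at most integrals of
  \<open>\<bar>\<Phi>'(z)\<bar> \<bar>u'\<bar> e\<^bsup>-\<phi>\<^esup>\<close>, which is integrable. So it tends to \<open>0\<close> once it takes arbitrarily small values
  (lemma \<open>flux_small_somewhere\<close>), and this is proved by contradiction. If \<open>\<bar>F\<bar> \<ge> \<gamma> > 0\<close> near infinity, then
  \<open>\<gamma> \<bar>\<phi>'\<bar> \<le> \<Phi>(z) e\<^bsup>-\<phi>\<^esup>\<close> and \<open>\<gamma> \<bar>u'\<bar> / \<bar>u\<bar> \<le> \<bar>\<Phi>'(z)\<bar> \<bar>u'\<bar> e\<^bsup>-\<phi>\<^esup>\<close> are integrable, so that \<open>\<phi>\<close> and \<open>u\<close>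
  are bounded there and \<open>\<bar>\<phi>'\<bar>\<close> takes arbitrarily small values. At such points \<open>\<Phi>(\<phi>' u) / \<phi>'\<close>
  is small, since \<open>\<Phi>\<close> is sublinear at \<open>0\<close>, and so is \<open>F\<close>.

  The function \<open>u\<close> has only a weak derivative. Testing with smooth approximations of indicator
  functions of intervals shows that \<open>u\<close> is an indefinite integral of it (lemma
  \<open>weak_derivative_has_integral\<close>), and the product and chain rules that lead to \<open>F'\<close> are proved
  directly for indefinite integrals (lemmas \<open>primitive_on_mult\<close> and \<open>primitive_on_compose\<close>), without
  differentiability at individual points.\<close>

section \<open>A smooth step function\<close>

text \<open>The family is closed under differentiation, so the smoothness of its members, including at the
  endpoints \<open>0\<close> and \<open>1\<close>, follows from the formula for one derivative. The member with \<open>q = 1\<close> and \<open>k = 0\<close> is the usual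
  bump function.\<close>

definition bump_term :: "real poly \<Rightarrow> nat \<Rightarrow> real \<Rightarrow> real" where
  "bump_term q k x =
     (if 0 < x \<and> x < 1 then poly q x / (x * (1 - x)) ^ k * exp (- 1 / (x * (1 - x))) else 0)"

text \<open>The exponential beats every power of \<open>x (1 - x)\<close>. Vanishing of second order at \<open>0\<close> and \<open>1\<close>
  gives the derivative \<open>0\<close> at these points.\<close>

lemma bump_term_quadratic_bound:
  obtains C where "\<And>x. \<bar>bump_term q k x\<bar> \<le> C * (x * (1 - x))\<^sup>2"
proof -
  have "compact (poly q ` {0..1})"
    by (intro compact_continuous_image continuous_intros) auto
  then obtain B where B: "\<And>x. x \<in> {0..1} \<Longrightarrow> \<bar>poly q x\<bar> \<le> B"
    by (meson bounded_real compact_imp_bounded image_eqI)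
  have B0: "0 \<le> B" using B[of 0] by force
  \<comment> \<open>\<open>e\<^bsup>-1/w\<^esup>\<close> is bounded by a multiple of \<open>w ^ n\<close>; two powers survive the division by \<open>w ^ k\<close>.\<close>
  define n where "n = k + 2"
  have "\<bar>bump_term q k x\<bar> \<le> B * real n ^ n * (x * (1 - x))\<^sup>2" for x
  proof (cases "0 < x \<and> x < 1")
    case True
    define w where "w = x * (1 - x)"
    have w: "0 < w" using True by (simp add: w_def)
    have "(1 + (1 / w) / real n) ^ n \<le> exp (1 / w)"
      by (rule exp_ge_one_plus_x_over_n_power_n) (use w order.trans[of "- real n" 0 "1 / w"] in \<open>auto simp: n_def\<close>)
    moreover have "((1 / w) / real n) ^ n \<le> (1 + (1 / w) / real n) ^ n"
      using w by (intro power_mono) auto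
    ultimately have "(1 / (w * real n)) ^ n \<le> exp (1 / w)" by simp
    then have "inverse (exp (1 / w)) \<le> inverse ((1 / (w * real n)) ^ n)"
      using w by (intro le_imp_inverse_le) (auto simp: n_def)
    then have e: "exp (- 1 / w) \<le> (w * real n) ^ n"
      by (simp add: exp_minus power_divide)
    have "\<bar>bump_term q k x\<bar> = \<bar>poly q x\<bar> / w ^ k * exp (- 1 / w)"
      using True w by (simp add: bump_term_def w_def abs_mult)
    also have "\<dots> \<le> B / w ^ k * (w * real n) ^ n"
      using e B[of x] True w B0 by (intro mult_mono divide_right_mono) auto
    also have "\<dots> = B * real n ^ n * w\<^sup>2"
      using w unfolding power_mult_distrib by (simp add: n_def power_add power2_eq_square)
    finally show ?thesis by (simp add: w_def)
  next
    case False
    then show ?thesis using B0 by (auto simp: bump_term_def intro!: mult_nonneg_nonneg)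
  qed
  then show thesis by (rule that)
qed

lemma DERIV_zero_of_quadratic_bound:
  fixes f :: "real \<Rightarrow> real"
  assumes "\<And>y. \<bar>f y - f x\<bar> \<le> C * (y - x)\<^sup>2"
  shows "(f has_real_derivative 0) (at x)"
proof -
  have "((\<lambda>y. (f y - f x) / (y - x)) \<longlongrightarrow> 0) (at x)"
  proof (rule Lim_null_comparison)
    show "\<forall>\<^sub>F y in at x. norm ((f y - f x) / (y - x)) \<le> C * \<bar>y - x\<bar>"
    proof (rule eventually_at_filter[THEN iffD2], intro always_eventually allI impI)
      fix y assume "y \<noteq> x"
      then show "norm ((f y - f x) / (y - x)) \<le> C * \<bar>y - x\<bar>"
        using assms[of y] by (simp add: power2_eq_square abs_mult divide_simps) 
    qed
    show "((\<lambda>y. C * \<bar>y - x\<bar>) \<longlongrightarrow> 0) (at x)"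
      by (auto intro!: tendsto_eq_intros)
  qed
  then show ?thesis by (simp add: has_field_derivative_iff)
qed

text \<open>The numerator after one differentiation of \<open>q w\<^bsup>-k\<^esup> e\<^bsup>-1/w\<^esup>\<close> with \<open>w = x (1 - x)\<close>, brought to the
  denominator \<open>w\<^bsup>k+2\<^esup>\<close>.\<close>

definition bump_step :: "real poly \<Rightarrow> nat \<Rightarrow> real poly" where
  "bump_step q k = pderiv q * [:0, 1, - 1:]\<^sup>2 - smult (real k) (q * [:1, - 2:] * [:0, 1, - 1:])
     + q * [:1, - 2:]"

lemma bump_term_DERIV:
  "(bump_term q k has_real_derivative bump_term (bump_step q k) (k + 2) x) (at x)"
proof -
  consider "x = 0 \<or> x = 1" | "x < 0 \<or> 1 < x" | "0 < x" "x < 1" by linarith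
  then show ?thesis
  proof cases
    case 1
    obtain C where C: "\<And>x. \<bar>bump_term q k x\<bar> \<le> C * (x * (1 - x))\<^sup>2"
      using bump_term_quadratic_bound[of q k] by blast
    have C0: "0 \<le> C" using C[of 2] by (simp add: bump_term_def)
    have x0: "bump_term q' k' x = 0" for q' k' using 1 by (auto simp: bump_term_def)
    have "\<bar>bump_term q k y\<bar> \<le> C * (y - x)\<^sup>2" for y
    proof (cases "0 < y \<and> y < 1")
      case True
      have "(y * (1 - y))\<^sup>2 \<le> (y - x)\<^sup>2"
      proof (rule abs_le_square_iff[THEN iffD1])
        show "\<bar>y * (1 - y)\<bar> \<le> \<bar>y - x\<bar>"
          using True 1 mult_right_mono[of y 1 "1-y"] by (auto simp: abs_mult mult_left_le)
      qed
      then show ?thesis using C[of y] mult_left_mono[OF _ C0] by (meson order.trans)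
    next
      case False then show ?thesis using C0 by (auto simp: bump_term_def)
    qed
    then show ?thesis using DERIV_zero_of_quadratic_bound[of "bump_term q k" x C] x0 by simp
  next
    case 2
    define U where "U = (if x < 0 then {..<0} else {1<..} :: real set)"
    have "((\<lambda>_. 0) has_real_derivative 0) (at x)" by simp
    then have "(bump_term q k has_real_derivative 0) (at x)"
      by (rule has_field_derivative_transform_within_open[of _ _ _ U])
         (use 2 in \<open>auto simp: U_def bump_term_def\<close>)
    moreover have "bump_term (bump_step q k) (k + 2) x = 0" using 2 by (auto simp: bump_term_def)
    ultimately show ?thesis by simp
  next
    case 3
    define w where "w = x * (1 - x)"
    have w: "0 < w" using 3 by (simp add: w_def)
    have xw: "x - x * x = w" "x - x\<^sup>2 = w" by (auto simp: w_def algebra_simps power2_eq_square)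
    have dW: "((\<lambda>x. x * (1 - x)) has_real_derivative (1 - 2 * x)) (at x)"
      by (auto intro!: derivative_eq_intros)
    have d1: "((\<lambda>x. exp (- 1 / (x * (1 - x)))) has_real_derivative
        exp (- 1 / w) * ((1 - 2 * x) / w\<^sup>2)) (at x)"
    proof -
      have "((\<lambda>x. - 1 / (x * (1 - x))) has_real_derivative (1 - 2 * x) / w\<^sup>2) (at x)"
        using DERIV_divide[OF DERIV_const dW, of "- 1"] w 3
        by (simp add: w_def power2_eq_square)
      from DERIV_chain2[OF DERIV_exp this] show ?thesis by (simp add: w_def)
    qed
    have d2: "((\<lambda>x. (x * (1 - x)) ^ k) has_real_derivative
        real k * (1 - 2 * x) * w ^ (k - 1)) (at x)"
      using DERIV_power[OF dW, of k] by (simp add: w_def algebra_simps)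
    have d3: "((\<lambda>x. poly q x / (x * (1 - x)) ^ k) has_real_derivative
        (poly (pderiv q) x * w ^ k - poly q x * (real k * (1 - 2 * x) * w ^ (k - 1))) / (w ^ k * w ^ k)) (at x)"
      using DERIV_divide[OF poly_DERIV d2, of q] w 3 unfolding w_def by simp
    have eq: "poly (pderiv q) x * w ^ k - poly q x * (real k * (1 - 2 * x) * w ^ (k - 1)) =
        w ^ k * (poly (pderiv q) x - poly q x * (real k * (1 - 2 * x)) / w)"
      using w by (cases k) (auto simp: field_simps)
    have "((\<lambda>x. poly q x / (x * (1 - x)) ^ k * exp (- 1 / (x * (1 - x)))) has_real_derivative
        bump_term (bump_step q k) (k + 2) x) (at x)"
    proof (rule DERIV_cong[OF DERIV_mult[OF d3 d1]])
      have p: "poly (bump_step q k) x = poly (pderiv q) x * w\<^sup>2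
            - real k * (poly q x * (1 - 2 * x) * w) + poly q x * (1 - 2 * x)"
        by (simp add: bump_step_def w_def algebra_simps power2_eq_square)
      show "(poly (pderiv q) x * w ^ k - poly q x * (real k * (1 - 2 * x) * w ^ (k - 1))) / (w ^ k * w ^ k)
          * exp (- 1 / (x * (1 - x))) + exp (- 1 / w) * ((1 - 2 * x) / w\<^sup>2) * (poly q x / (x * (1 - x)) ^ k)
          = bump_term (bump_step q k) (k + 2) x"
        unfolding eq using w 3 by (simp add: bump_term_def p flip: w_def) (simp add: power_add field_simps power2_eq_square)
    qed
    then show ?thesis
      by (rule has_field_derivative_transform_within_open[of _ _ _ "{0<..<1}"])
         (use 3 in \<open>auto simp: bump_term_def\<close>)
  qed
qed

definition smooth :: "(real \<Rightarrow> real) \<Rightarrow> bool" where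
  "smooth f \<longleftrightarrow> (\<forall>n x. (deriv ^^ n) f differentiable (at x))"

lemma deriv_bump_term: "deriv (bump_term q k) = bump_term (bump_step q k) (k + 2)"
  using DERIV_imp_deriv[OF bump_term_DERIV] by blast

lemma smooth_bump_term: "smooth (bump_term q k)"
proof -
  have "\<exists>q' k'. (deriv ^^ n) (bump_term q k) = bump_term q' k'" for n
  proof (induction n)
    case (Suc n)
    then show ?case by (metis comp_apply deriv_bump_term funpow.simps(2))
  qed auto
  then show ?thesis unfolding smooth_def
    by (metis bump_term_DERIV real_differentiable_def)
qed

lemma smooth_if_smooth_deriv:
  assumes "\<And>x. f differentiable (at x)" "smooth (deriv f)"
  shows "smooth f"
  unfolding smooth_def
proof (intro allI)
  fix n x show "(deriv ^^ n) f differentiable (at x)"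
    using assms by (cases n) (auto simp: smooth_def funpow_swap1)
qed

lemma smooth_rescaled_difference:
  assumes "smooth f"
  shows "smooth (\<lambda>x. f ((x - a) / e) - f ((x - b) / e))"
proof -
  define g where "g n x = ((deriv ^^ n) f ((x - a) / e) - (deriv ^^ n) f ((x - b) / e)) / e ^ n" for n x
  have D: "((deriv ^^ n) f has_real_derivative (deriv ^^ Suc n) f x) (at x)" for n x
    using assms by (simp add: smooth_def DERIV_deriv_iff_real_differentiable)
  have chain: "((\<lambda>x. (deriv ^^ n) f ((x - p) / e)) has_real_derivative
      (deriv ^^ Suc n) f ((x - p) / e) / e) (at x)" for n p x
  proof -
    have "((\<lambda>x. (x - p) / e) has_real_derivative 1 / e) (at x)"
      by (rule DERIV_cdivide) (auto intro!: derivative_eq_intros)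
    from DERIV_chain2[OF D this] show ?thesis by simp
  qed
  have dg: "(g n has_real_derivative g (Suc n) x) (at x)" for n x
    unfolding g_def[abs_def]
    by (rule DERIV_cong[OF DERIV_cdivide[OF DERIV_diff[OF chain chain]]])
       (simp add: diff_divide_distrib del: funpow.simps)
  have "(deriv ^^ n) (\<lambda>x. f ((x - a) / e) - f ((x - b) / e)) = g n" for n
  proof (induction n)
    case 0 then show ?case by (simp add: g_def[abs_def])
  next
    case (Suc n)
    then show ?case using DERIV_imp_deriv[OF dg] by auto
  qed
  then show ?thesis unfolding smooth_def using dg real_differentiable_def by metis
qed

definition step_mass :: real where "step_mass = integral {0..1} (bump_term 1 0)"

text \<open>The lower limit \<open>- 1\<close> lies to the left of the support of the bump, so that the
  differentiation rule for indefinite integrals applies at \<open>0\<close> as well.\<close>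

definition smooth_step :: "real \<Rightarrow> real" where
  "smooth_step x = integral {-1..x} (bump_term 1 0) / step_mass"

lemma bump_nonneg: "0 \<le> bump_term 1 0 x" by (simp add: bump_term_def)

lemma continuous_on_bump_term: "continuous_on S (bump_term q k)"
  by (intro continuous_at_imp_continuous_on ballI DERIV_isCont[OF bump_term_DERIV])

lemma step_mass_pos: "0 < step_mass"
proof -
  have "step_mass \<noteq> 0"
  proof
    assume "step_mass = 0"
    moreover have "(bump_term 1 0) integrable_on {0..1::real}"
      by (intro integrable_continuous_interval continuous_on_bump_term)
    ultimately have "(bump_term 1 0 has_integral 0) (cbox 0 1)"
      by (simp add: step_mass_def has_integral_integrable_integral)
    then have "bump_term 1 0 (1/2) = 0"
      by (rule has_integral_0_cbox_imp_0[OF continuous_on_bump_term bump_nonneg]) auto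
    then show False by (simp add: bump_term_def)
  qed
  moreover have "0 \<le> step_mass" unfolding step_mass_def
    by (rule integral_nonneg[OF integrable_continuous_interval[OF continuous_on_bump_term]])
       (rule bump_nonneg)
  ultimately show ?thesis by simp
qed

lemma smooth_step_eq_0: "x \<le> 0 \<Longrightarrow> smooth_step x = 0"
proof -
  assume "x \<le> 0"
  then have "integral {-1..x} (bump_term 1 0) = integral {-1..x} (\<lambda>_. 0)"
    by (intro integral_cong) (auto simp: bump_term_def)
  then show ?thesis by (simp add: smooth_step_def)
qed

lemma smooth_step_DERIV: "(smooth_step has_real_derivative bump_term 1 0 x / step_mass) (at x)"
proof (cases "x < 0")
  case True
  have "((\<lambda>_. 0) has_real_derivative 0) (at x)" by simp
  then have "(smooth_step has_real_derivative 0) (at x)"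
    by (rule has_field_derivative_transform_within_open[of _ _ _ "{..<0}"])
       (use True in \<open>auto simp: smooth_step_eq_0\<close>)
  then show ?thesis using True by (simp add: bump_term_def)
next
  case False
  have "((\<lambda>x. integral {-1..x} (bump_term 1 0)) has_real_derivative bump_term 1 0 x) (at x within {-1..x+1})"
    using False by (intro integral_has_real_derivative continuous_on_bump_term) auto
  then have "((\<lambda>x. integral {-1..x} (bump_term 1 0)) has_real_derivative bump_term 1 0 x) (at x)"
    using False by (simp add: at_within_Icc_at)
  then show ?thesis unfolding smooth_step_def[abs_def] by (rule DERIV_cdivide)
qed

lemma smooth_step_eq_1: "1 \<le> x \<Longrightarrow> smooth_step x = 1"
proof -
  assume x: "1 \<le> x"
  have "(bump_term 1 0 has_integral step_mass) {0..1}"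
    unfolding step_mass_def by (intro integrable_integral integrable_continuous_interval continuous_on_bump_term)
  then have "(bump_term 1 0 has_integral step_mass) {-1..x}"
    by (rule has_integral_on_superset) (use x in \<open>auto simp: bump_term_def\<close>)
  then show ?thesis using step_mass_pos by (simp add: smooth_step_def integral_unique)
qed

lemma smooth_smooth_step: "smooth smooth_step"
proof (rule smooth_if_smooth_deriv)
  show "smooth_step differentiable (at x)" for x
    using smooth_step_DERIV real_differentiable_def by blast
  have "bump_term 1 0 x / step_mass = bump_term [:1 / step_mass:] 0 x" for x
    by (simp add: bump_term_def)
  then have "deriv smooth_step = bump_term [:1 / step_mass:] 0"
    using DERIV_imp_deriv[OF smooth_step_DERIV] by (metis ext)
  then show "smooth (deriv smooth_step)" by (simp add: smooth_bump_term)
qed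

lemma smooth_step_range: "0 \<le> smooth_step x" "smooth_step x \<le> 1"
proof -
  have mono: "smooth_step x \<le> smooth_step y" if "x \<le> y" for x y
    by (rule DERIV_nonneg_imp_nondecreasing[OF that])
       (use smooth_step_DERIV bump_nonneg step_mass_pos in \<open>auto intro!: exI divide_nonneg_pos\<close>)
  show "0 \<le> smooth_step x"
    using mono[of "min x 0" x] smooth_step_eq_0[of "min x 0"] by simp
  show "smooth_step x \<le> 1"
    using mono[of x "max x 1"] smooth_step_eq_1[of "max x 1"] by simp
qed

section \<open>From weak derivatives to integrals\<close>

text \<open>As \<open>e\<close> tends to \<open>0\<close>, this tends to the indicator function of \<open>{a<..b}\<close>, and its derivative, a
  difference of two mollifiers, to the difference of the point masses at \<open>a\<close> and \<open>b\<close>.\<close>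

definition cutoff :: "real \<Rightarrow> real \<Rightarrow> real \<Rightarrow> real \<Rightarrow> real" where
  "cutoff a b e x = smooth_step ((x - a) / e) - smooth_step ((x - b) / e)"

definition mollifier :: "real \<Rightarrow> real \<Rightarrow> real \<Rightarrow> real" where
  "mollifier a e x = bump_term 1 0 ((x - a) / e) / step_mass / e"

lemma rescaled_step_DERIV:
  "((\<lambda>x. smooth_step ((x - a) / e)) has_real_derivative mollifier a e x) (at x)"
proof -
  have "((\<lambda>x. (x - a) / e) has_real_derivative 1 / e) (at x)"
    by (rule DERIV_cdivide) (auto intro!: derivative_eq_intros)
  from DERIV_chain2[OF smooth_step_DERIV this] show ?thesis by (simp add: mollifier_def)
qed

lemma deriv_cutoff: "deriv (cutoff a b e) x = mollifier a e x - mollifier b e x"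
  unfolding cutoff_def[abs_def]
  by (intro DERIV_imp_deriv DERIV_diff rescaled_step_DERIV)

lemma cutoff_eq_0:
  assumes "0 < e" "a \<le> b" "x \<notin> {a..b + e}"
  shows "cutoff a b e x = 0"
  using assms smooth_step_eq_0[of "(x - a) / e"] smooth_step_eq_0[of "(x - b) / e"]
    smooth_step_eq_1[of "(x - a) / e"] smooth_step_eq_1[of "(x - b) / e"]
  by (auto simp: cutoff_def divide_le_0_iff le_divide_eq)

lemma cutoff_le_1: "\<bar>cutoff a b e x\<bar> \<le> 1"
  using smooth_step_range[of "(x - a) / e"] smooth_step_range[of "(x - b) / e"]
  by (auto simp: cutoff_def)

lemma test_function_cutoff:
  assumes "0 < e" "0 < a" "a \<le> b"
  shows "test_function (cutoff a b e)"
proof -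
  have sub: "closure {x. cutoff a b e x \<noteq> 0} \<subseteq> {a..b + e}"
    by (rule closure_minimal) (use cutoff_eq_0[OF assms(1,3)] in blast, simp)
  then have "compact (closure {x. cutoff a b e x \<noteq> 0})"
    using bounded_subset[OF bounded_closed_interval] by (simp add: compact_eq_bounded_closed)
  moreover have "smooth (cutoff a b e)"
    unfolding cutoff_def[abs_def] by (rule smooth_rescaled_difference[OF smooth_smooth_step])
  ultimately show ?thesis using sub assms by (force simp: test_function_def smooth_def)
qed

lemma half_line_integral:
  fixes f :: "real \<Rightarrow> real"
  assumes "f absolutely_integrable_on {a..b}" "0 < a" "\<And>x. x \<notin> {a..b} \<Longrightarrow> f x = 0"
  shows "integrable (lebesgue_on {0<..}) f"
    and "(LINT x|lebesgue_on {0<..}. f x) = integral {a..b} f"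
proof -
  have eq: "indicator {0<..} x * f x = indicator {a..b} x * f x" for x
    using assms(2,3) by (force simp: indicator_def)
  show "integrable (lebesgue_on {0<..}) f"
    using assms(1) by (simp add: integrable_restrict_space set_integrable_def eq)
  show "(LINT x|lebesgue_on {0<..}. f x) = integral {a..b} f"
    using set_lebesgue_integral_eq_integral(2)[OF assms(1)]
    by (simp add: integral_restrict_space set_lebesgue_integral_def eq)
qed

lemma integrable_indicator_interval:
  fixes v :: "real \<Rightarrow> real"
  assumes v: "v absolutely_integrable_on {a..b}" and a: "0 < a"
  shows "integrable (lebesgue_on {0<..}) (\<lambda>x. indicator {a..b} x * v x)"
proof (rule half_line_integral(1))
  show "(\<lambda>x. indicator {a..b} x * v x) absolutely_integrable_on {a..b}"
    using v by (simp add: set_integrable_def flip: mult.assoc indicator_inter_arith)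
qed (use a in simp_all)

lemma mollifier_eq_0: "0 < e \<Longrightarrow> x \<notin> {a..a + e} \<Longrightarrow> mollifier a e x = 0"
  by (auto simp: mollifier_def bump_term_def field_simps)

lemma mollifier_nonneg: "0 < e \<Longrightarrow> 0 \<le> mollifier a e x"
  using step_mass_pos bump_nonneg by (simp add: mollifier_def)

lemma continuous_on_mollifier: "continuous_on S (mollifier a e)"
  unfolding mollifier_def[abs_def] divide_inverse
  by (intro continuous_intros continuous_on_compose2[OF continuous_on_bump_term[of UNIV]]) auto

lemma mollifier_has_integral: "0 < e \<Longrightarrow> (mollifier a e has_integral 1) {a..a + e}"
  using fundamental_theorem_of_calculus[of a "a + e" "\<lambda>x. smooth_step ((x - a) / e)" "mollifier a e"]
    rescaled_step_DERIV[of a e]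
  by (auto simp: smooth_step_eq_0 smooth_step_eq_1 has_real_derivative_iff_has_vector_derivative
      intro: has_vector_derivative_at_within)

lemma mollifier_average:
  assumes u: "continuous_on {0<..} u" and a: "0 < a" and e: "0 < e"
  shows "integrable (lebesgue_on {0<..}) (\<lambda>x. u x * mollifier a e x)"
    and "(\<And>x. x \<in> {a..a + e} \<Longrightarrow> \<bar>u x - u a\<bar> \<le> \<eta>) \<Longrightarrow>
      \<bar>(LINT x|lebesgue_on {0<..}. u x * mollifier a e x) - u a\<bar> \<le> \<eta>"
proof -
  have cu: "continuous_on {a..a + e} u" by (rule continuous_on_subset[OF u]) (use a in auto)
  have cont: "continuous_on {a..a + e} (\<lambda>x. u x * mollifier a e x)"
    by (intro continuous_on_mult cu continuous_on_mollifier)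
  then have ai: "(\<lambda>x. u x * mollifier a e x) absolutely_integrable_on {a..a + e}"
    by (rule absolutely_integrable_continuous_real)
  note hl = half_line_integral[OF ai a]
  show "integrable (lebesgue_on {0<..}) (\<lambda>x. u x * mollifier a e x)"
    by (rule hl(1)) (simp add: mollifier_eq_0[OF e])
  assume \<eta>: "\<And>x. x \<in> {a..a + e} \<Longrightarrow> \<bar>u x - u a\<bar> \<le> \<eta>"
  have "((\<lambda>x. u x * mollifier a e x) has_integral integral {a..a + e} (\<lambda>x. u x * mollifier a e x)) {a..a + e}"
    using cont by (intro integrable_integral integrable_continuous_interval)
  from has_integral_diff[OF this has_integral_mult_right[OF mollifier_has_integral[OF e], of "u a"]]
  have d: "((\<lambda>x. u x * mollifier a e x - u a * mollifier a e x) has_integral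
      (integral {a..a + e} (\<lambda>x. u x * mollifier a e x) - u a)) {a..a + e}" by simp
  have "norm (integral {a..a + e} (\<lambda>x. u x * mollifier a e x - u a * mollifier a e x))
      \<le> integral {a..a + e} (\<lambda>x. \<eta> * mollifier a e x)"
  proof (rule integral_norm_bound_integral)
    show "(\<lambda>x. u x * mollifier a e x - u a * mollifier a e x) integrable_on {a..a + e}"
      using d by blast
    show "(\<lambda>x. \<eta> * mollifier a e x) integrable_on {a..a + e}"
      using has_integral_mult_right[OF mollifier_has_integral[OF e]] by blast
    show "norm (u x * mollifier a e x - u a * mollifier a e x) \<le> \<eta> * mollifier a e x" if "x \<in> {a..a + e}" for x
      using mult_right_mono[OF \<eta>[OF that] mollifier_nonneg[OF e]] mollifier_nonneg[OF e, of a x]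
      by (simp add: abs_mult flip: left_diff_distrib)
  qed
  then show "\<bar>(LINT x|lebesgue_on {0<..}. u x * mollifier a e x) - u a\<bar> \<le> \<eta>"
    using integral_unique[OF d] integral_unique[OF mollifier_has_integral[OF e]]
    by (subst hl(2)) (simp_all add: mollifier_eq_0[OF e])
qed

lemma mollifier_average_tendsto:
  assumes u: "continuous_on {0<..} u" and a: "0 < a"
  shows "(\<lambda>n. LINT x|lebesgue_on {0<..}. u x * mollifier a (1 / real (Suc n)) x) \<longlonglongrightarrow> u a"
proof (rule LIMSEQ_I)
  fix r :: real assume r: "0 < r"
  have "isCont u a" using u a by (simp add: continuous_on_eq_continuous_at)
  then obtain \<delta> where \<delta>: "0 < \<delta>" "\<And>x. \<bar>x - a\<bar> < \<delta> \<Longrightarrow> \<bar>u x - u a\<bar> < r / 2"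
    using r by (metis continuous_at_eps_delta dist_real_def half_gt_zero)
  obtain N where N: "1 / real (Suc N) < \<delta>" using \<delta>(1) nat_approx_posE by blast
  show "\<exists>no. \<forall>n\<ge>no. norm ((LINT x|lebesgue_on {0<..}. u x * mollifier a (1 / real (Suc n)) x) - u a) < r"
  proof (intro exI allI impI)
    fix n assume "N \<le> n"
    then have "1 / real (Suc n) \<le> 1 / real (Suc N)" by (simp add: frac_le)
    then have "\<bar>u x - u a\<bar> \<le> r / 2" if "x \<in> {a..a + 1 / real (Suc n)}" for x
      using \<delta>(2)[of x] N that by fastforce
    from mollifier_average(2)[OF u a, of "1 / real (Suc n)", OF _ this]
    show "norm ((LINT x|lebesgue_on {0<..}. u x * mollifier a (1 / real (Suc n)) x) - u a) < r"
      using r by (simp del: of_nat_Suc)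
  qed
qed

lemma rescaled_step_tendsto:
  "(\<lambda>n. smooth_step ((x - a) / (1 / real (Suc n)))) \<longlonglongrightarrow> indicator {a<..} x"
proof (cases "a < x")
  case True
  obtain N where N: "1 / (x - a) < real N" using reals_Archimedean2 by blast
  have "\<forall>\<^sub>F n in sequentially. smooth_step ((x - a) / (1 / real (Suc n))) = indicator {a<..} x"
    using eventually_ge_at_top[of N]
  proof eventually_elim
    case (elim n)
    then have "1 / (x - a) \<le> real (Suc n)" using N by simp
    then show ?case using True by (simp add: smooth_step_eq_1 field_simps)
  qed
  then show ?thesis by (rule tendsto_eventually)
next
  case False
  then show ?thesis by (simp add: smooth_step_eq_0 mult_nonpos_nonneg)
qed

text \<open>Testing the weak derivative with \<open>cutoff a b e\<close> and letting \<open>e\<close> tend to \<open>0\<close> turns the left-hand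
  side of the definition into \<open>u a - u b\<close>, by continuity of \<open>u\<close>, and the right-hand side into the
  integral of \<open>- v\<close>, by dominated convergence.\<close>

lemma weak_derivative_has_integral:
  assumes w: "weak_derivative u v" and u: "continuous_on {0<..} u" and a: "0 < a" and ab: "a \<le> b"
  shows "(v has_integral (u b - u a)) {a..b}"
proof -
  let ?L = "lebesgue_on {0<..} :: real measure"
  define e where "e n = 1 / real (Suc n)" for n
  have e: "0 < e n" "e n \<le> 1" for n by (auto simp: e_def)
  have b: "0 < b" using a ab by simp
  have v: "v absolutely_integrable_on {a..b + 1}"
  proof -
    have "locally_integrable v" using w by (simp add: weak_derivative_def)
    moreover have "compact {a..b + 1}" "{a..b + 1} \<subseteq> {0<..}" using a by auto
    ultimately show ?thesis unfolding locally_integrable_def by blast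
  qed
  \<comment> \<open>All the cutoffs involved vanish outside \<open>{a..b + 1}\<close>; the restriction of \<open>v\<close> to this interval
     serves as integrable majorant.\<close>
  define v' where "v' x = indicator {a..b + 1} x * v x" for x
  have v': "integrable ?L v'"
    unfolding v'_def by (rule integrable_indicator_interval[OF v a])
  have cut: "v x * cutoff a b (e n) x = v' x * cutoff a b (e n) x" for n x
    
  proof (cases "x \<in> {a..b + e n}")
    case True
    then show ?thesis using e(2)[of n] by (simp add: v'_def)
  qed (simp add: cutoff_eq_0[OF e(1) ab])
  have "(LINT x|?L. u x * deriv (cutoff a b (e n)) x) = - (LINT x|?L. v x * cutoff a b (e n) x)" for n
    using w test_function_cutoff[OF e(1) a ab] by (simp add: weak_derivative_def)
  then have eq: "(LINT x|?L. u x * mollifier a (e n) x) - (LINT x|?L. u x * mollifier b (e n) x)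
      = - (LINT x|?L. v' x * cutoff a b (e n) x)" for n
    using mollifier_average(1)[OF u a e(1)] mollifier_average(1)[OF u b e(1)]
    by (simp add: deriv_cutoff right_diff_distrib cut)
  have "(\<lambda>n. LINT x|?L. v' x * cutoff a b (e n) x) \<longlonglongrightarrow> (LINT x|?L. v' x * (indicator {a<..} x - indicator {b<..} x))"
  proof (rule integral_dominated_convergence[where w = "\<lambda>x. \<bar>v' x\<bar>"])
    have "cutoff a b (e n) \<in> borel_measurable borel" for n
      unfolding cutoff_def[abs_def]
      by (intro borel_measurable_continuous_onI continuous_at_imp_continuous_on ballI
          DERIV_isCont[OF DERIV_diff[OF rescaled_step_DERIV rescaled_step_DERIV]])
    then have "cutoff a b (e n) \<in> borel_measurable ?L" for n
      by (intro measurable_restrict_space1 measurable_completion) simp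
    then show "(\<lambda>x. v' x * cutoff a b (e n) x) \<in> borel_measurable ?L" for n
      using v' by (intro borel_measurable_times) auto
    have "(\<lambda>x. indicator {a<..} x - indicator {b<..} x :: real) \<in> borel_measurable ?L"
      by (intro measurable_restrict_space1 measurable_completion) simp
    then show "(\<lambda>x. v' x * (indicator {a<..} x - indicator {b<..} x)) \<in> borel_measurable ?L"
      using v' by (intro borel_measurable_times) auto
    show "integrable ?L (\<lambda>x. \<bar>v' x\<bar>)" using v' by simp
    show "AE x in ?L. (\<lambda>n. v' x * cutoff a b (e n) x) \<longlonglongrightarrow> v' x * (indicator {a<..} x - indicator {b<..} x)"
      unfolding cutoff_def e_def by (intro AE_I2 tendsto_intros rescaled_step_tendsto)
    show "AE x in ?L. norm (v' x * cutoff a b (e n) x) \<le> \<bar>v' x\<bar>" for n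
      using cutoff_le_1 by (intro AE_I2) (simp add: abs_mult mult_left_le)
  qed
  moreover have "(\<lambda>n. (LINT x|?L. u x * mollifier a (e n) x) - (LINT x|?L. u x * mollifier b (e n) x))
      \<longlonglongrightarrow> u a - u b"
    unfolding e_def
    by (intro tendsto_diff mollifier_average_tendsto[OF u a] mollifier_average_tendsto[OF u b])
  then have "(\<lambda>n. - (LINT x|?L. v' x * cutoff a b (e n) x)) \<longlonglongrightarrow> u a - u b"
    by (simp only: eq)
  ultimately have lim: "(LINT x|?L. v' x * (indicator {a<..} x - indicator {b<..} x)) = u b - u a"
    using LIMSEQ_unique[OF tendsto_minus] by fastforce
  have vab: "v absolutely_integrable_on {a..b}"
    by (rule set_integrable_subset[OF v]) auto
  define f where "f x = v' x * (indicator {a<..} x - indicator {b<..} x)" for x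
  have fv: "f x = v x" if "x \<in> {a..b} - {a}" for x
    using that by (auto simp: f_def v'_def)
  have f0: "f x = 0" if "x \<notin> {a..b}" for x
    using that ab by (auto simp: f_def v'_def indicator_def)
  have "f absolutely_integrable_on {a..b}"
    using vab fv absolutely_integrable_spike_eq[of "{a}" "{a..b}" v f] by simp
  from half_line_integral(2)[OF this a f0] have "integral {a..b} f = u b - u a"
    using lim by (simp add: f_def[abs_def])
  moreover have "integral {a..b} f = integral {a..b} v"
    by (rule integral_spike[of "{a}"]) (use fv in auto)
  ultimately show ?thesis
    using vab by (simp add: has_integral_integrable_integral set_lebesgue_integral_eq_integral(1))
qed

lemma locally_absolutely_continuous_imp_continuous_on:
  assumes "locally_absolutely_continuous u"
  shows "continuous_on {0<..} u"
  unfolding continuous_on_iff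
proof (intro ballI allI impI)
  fix x \<epsilon> :: real assume x: "x \<in> {0<..}" and "0 < \<epsilon>"
  then have "0 < x / 2 \<and> x / 2 \<le> 2 * x" by auto
  from assms[unfolded locally_absolutely_continuous_def, THEN spec, THEN spec, THEN mp, OF this,
      THEN spec, THEN mp, OF \<open>0 < \<epsilon>\<close>]
  obtain \<delta> where \<delta>: "0 < \<delta>" and
    D: "\<forall>n X Y. (\<forall>i<n. x / 2 \<le> X i \<and> X i \<le> Y i \<and> Y i \<le> 2 * x) \<and>
      disjoint_family_on (\<lambda>i. {X i<..<Y i}) {..<n} \<and> (\<Sum>i<n. Y i - X i) < \<delta>
      \<longrightarrow> (\<Sum>i<(n::nat). \<bar>u (Y i) - u (X i)\<bar>) < \<epsilon>"
    by (elim exE conjE)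
  show "\<exists>d>0. \<forall>x'\<in>{0<..}. dist x' x < d \<longrightarrow> dist (u x') (u x) < \<epsilon>"
  proof (intro exI[of _ "min \<delta> (x / 2)"] conjI ballI impI)
    fix y assume "y \<in> {0<..}" "dist y x < min \<delta> (x / 2)"
    then have "\<bar>y - x\<bar> < \<delta>" "\<bar>y - x\<bar> < x / 2" by (simp_all add: dist_real_def)
    then have y: "x / 2 \<le> min x y" "max x y \<le> 2 * x" "max x y - min x y < \<delta>"
      by (auto simp: min_def max_def abs_if split: if_splits)
    have "disjoint_family_on (\<lambda>i::nat. {min x y<..<max x y}) {..<1}"
      by (simp add: disjoint_family_on_def)
    then have "\<bar>u (max x y) - u (min x y)\<bar> < \<epsilon>"
      using D[rule_format, of 1 "\<lambda>_. min x y" "\<lambda>_. max x y"] y by simp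
    then show "dist (u y) (u x) < \<epsilon>"
      by (simp add: dist_real_def min_def max_def abs_minus_commute split: if_splits)
  qed (use x \<delta> in auto)
qed

section \<open>Product and chain rule for indefinite integrals\<close>

text \<open>A function whose increments over short intervals are small compared with those of a fixed
  function \<open>W\<close> is constant: summing over a partition, the increments of \<open>W\<close> telescope. It takes the
  place of the rule that a vanishing derivative makes a function constant.\<close>

lemma eq_at_endpoints_if_locally_dominated:
  fixes A W :: "real \<Rightarrow> real"
  assumes ab: "a \<le> b"
    and loc: "\<And>\<epsilon>. 0 < \<epsilon> \<Longrightarrow> \<exists>\<delta>>0. \<forall>x y. a \<le> x \<longrightarrow> x \<le> y \<longrightarrow> y \<le> b \<longrightarrow> y - x < \<delta> \<longrightarrow>
      \<bar>A y - A x\<bar> \<le> \<epsilon> * (W y - W x)"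
  shows "A b = A a"
proof -
  have bound: "\<bar>A b - A a\<bar> \<le> \<epsilon> * (W b - W a)" if "0 < \<epsilon>" for \<epsilon>
  proof -
    obtain \<delta> where \<delta>: "0 < \<delta>" and D: "\<And>x y. a \<le> x \<Longrightarrow> x \<le> y \<Longrightarrow> y \<le> b \<Longrightarrow> y - x < \<delta> \<Longrightarrow>
      \<bar>A y - A x\<bar> \<le> \<epsilon> * (W y - W x)"
      using loc[OF \<open>0 < \<epsilon>\<close>] by blast
    obtain n where n: "(b - a) / \<delta> < real n" using reals_Archimedean2 by blast
    have n0: "0 < real n" using n ab \<delta> by (smt (verit) divide_nonneg_pos)
    define p where "p k = a + real k * ((b - a) / real n)" for k
    have step: "(b - a) / real n < \<delta>" "0 \<le> (b - a) / real n"
      using n n0 \<delta> ab by (auto simp: field_simps)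
    have pb: "p k \<le> b" if "k \<le> n" for k
    proof -
      have "real k * ((b - a) / real n) \<le> real n * ((b - a) / real n)"
        using that step(2) by (intro mult_right_mono) auto
      then show ?thesis using n0 by (simp add: p_def)
    qed
    have pa: "a \<le> p k" for k
      unfolding p_def using step(2) by (metis le_add_same_cancel1 mult_nonneg_nonneg of_nat_0_le_iff)
    have pS: "p (Suc k) = p k + (b - a) / real n" for k
      by (simp add: p_def distrib_right add_divide_distrib)
    have "\<bar>A (p k) - A a\<bar> \<le> \<epsilon> * (W (p k) - W a)" if "k \<le> n" for k
      using that
    proof (induction k)
      case 0 then show ?case by (simp add: p_def)
    next
      case (Suc k)
      have "\<bar>A (p (Suc k)) - A (p k)\<bar> \<le> \<epsilon> * (W (p (Suc k)) - W (p k))"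
        by (rule D) (use step pS[of k] pb[OF Suc.prems] pa in auto)
      with Suc show ?case by (simp add: right_diff_distrib)
    qed
    from this[of n] show ?thesis using n0 by (simp add: p_def)
  qed
  have "\<bar>A b - A a\<bar> \<le> 0 + r" if "0 < r" for r
  proof -
    define K where "K = \<bar>W b - W a\<bar> + 1"
    have K: "0 < K" "W b - W a \<le> K" by (auto simp: K_def)
    have "\<bar>A b - A a\<bar> \<le> r / K * (W b - W a)" by (rule bound) (use that K in simp)
    also have "\<dots> \<le> r / K * K" using that K by (intro mult_left_mono) auto
    finally show ?thesis using K by simp
  qed
  then show ?thesis using field_le_epsilon[of "\<bar>A b - A a\<bar>" 0] by simp
qed

text \<open>For \<open>a \<le> b\<close> this says that \<open>u\<close> is absolutely continuous on \<open>{a..b}\<close> with derivative \<open>v\<close> almost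
  everywhere; expressed by integrals, it involves no points of differentiability.\<close>

definition primitive_on :: "real \<Rightarrow> real \<Rightarrow> (real \<Rightarrow> real) \<Rightarrow> (real \<Rightarrow> real) \<Rightarrow> bool" where
  "primitive_on a b u v \<longleftrightarrow> v absolutely_integrable_on {a..b} \<and>
     (\<forall>x y. a \<le> x \<longrightarrow> x \<le> y \<longrightarrow> y \<le> b \<longrightarrow> (v has_integral (u y - u x)) {x..y})"

lemma primitive_onD:
  assumes "primitive_on a b u v" "a \<le> x" "x \<le> y" "y \<le> b"
  shows "(v has_integral (u y - u x)) {x..y}" "v absolutely_integrable_on {x..y}"
proof -
  show "(v has_integral (u y - u x)) {x..y}" using assms by (simp add: primitive_on_def)
  have "v absolutely_integrable_on {a..b}" using assms by (simp add: primitive_on_def)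
  then show "v absolutely_integrable_on {x..y}"
    by (rule set_integrable_subset) (use assms in auto)
qed

lemma primitive_on_continuous:
  assumes "primitive_on a b u v"
  shows "continuous_on {a..b} u"
proof (cases "a \<le> b")
  case True
  have "v integrable_on {a..b}"
    using primitive_onD(1)[OF assms order.refl True order.refl] by blast
  then have "continuous_on {a..b} (\<lambda>x. u a + integral {a..x} v)"
    by (intro continuous_intros indefinite_integral_continuous_1)
  then show ?thesis
  proof (rule continuous_on_eq)
    fix x assume "x \<in> {a..b}"
    then show "u a + integral {a..x} v = u x"
      using integral_unique[OF primitive_onD(1)[OF assms order.refl, of x]] by simp
  qed
qed simp

lemma uniform_modulus:
  fixes f :: "real \<Rightarrow> real"
  assumes "continuous_on {a..b} f" "0 < \<epsilon>"
  obtains \<delta> where "0 < \<delta>"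
    "\<And>x y s t. \<lbrakk>a \<le> x; y \<le> b; y - x < \<delta>; s \<in> {x..y}; t \<in> {x..y}\<rbrakk> \<Longrightarrow> \<bar>f s - f t\<bar> \<le> \<epsilon>"
proof -
  have "uniformly_continuous_on {a..b} f"
    by (rule compact_uniformly_continuous[OF assms(1)]) simp
  then obtain \<delta> where \<delta>: "0 < \<delta>" "\<And>s t. s \<in> {a..b} \<Longrightarrow> t \<in> {a..b} \<Longrightarrow> dist t s < \<delta> \<Longrightarrow> dist (f t) (f s) < \<epsilon>"
    using assms(2) unfolding uniformly_continuous_on_def by metis
  show thesis
  proof (rule that[OF \<delta>(1)])
    fix x y s t assume "a \<le> x" "y \<le> b" "y - x < \<delta>" "s \<in> {x..y}" "t \<in> {x..y}"
    then have "s \<in> {a..b}" "t \<in> {a..b}" "\<bar>s - t\<bar> < \<delta>" by auto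
    then show "\<bar>f s - f t\<bar> \<le> \<epsilon>" using \<delta>(2)[of t s] by (simp add: dist_real_def)
  qed
qed

text \<open>Being a primitive can be checked on short intervals, with an error that is small compared with
  the integral of a fixed function.\<close>

lemma primitive_onI_local:
  fixes G g w :: "real \<Rightarrow> real"
  assumes g: "g absolutely_integrable_on {a..b}" and w: "w absolutely_integrable_on {a..b}"
    and loc: "\<And>\<epsilon>. 0 < \<epsilon> \<Longrightarrow> \<exists>\<delta>>0. \<forall>x y. a \<le> x \<longrightarrow> x \<le> y \<longrightarrow> y \<le> b \<longrightarrow> y - x < \<delta> \<longrightarrow>
      \<bar>G y - G x - integral {x..y} g\<bar> \<le> \<epsilon> * integral {x..y} w"
  shows "primitive_on a b G g"
  unfolding primitive_on_def
proof (intro conjI allI impI g)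
  fix c d assume cd: "a \<le> c" "c \<le> d" "d \<le> b"
  have int: "f integrable_on {x..y}" if "f absolutely_integrable_on {a..b}" "c \<le> x" "y \<le> d" for f :: "real \<Rightarrow> real" and x y
    using set_lebesgue_integral_eq_integral(1)[OF set_integrable_subset[OF that(1), of "{x..y}"]] that cd
    by (simp add: subset_eq)
  have split: "integral {c..y} f - integral {c..x} f = integral {x..y} f"
    if "f absolutely_integrable_on {a..b}" "c \<le> x" "x \<le> y" "y \<le> d" for f :: "real \<Rightarrow> real" and x y
    using Henstock_Kurzweil_Integration.integral_combine[OF that(2,3) int[OF that(1) order.refl that(4)]]
    by simp
  have "G d - integral {c..d} g = G c - integral {c..c} g"
  proof (rule eq_at_endpoints_if_locally_dominated[OF cd(2), where W = "\<lambda>x. integral {c..x} w"])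
    fix \<epsilon> :: real assume "0 < \<epsilon>"
    from loc[OF this] obtain \<delta> where \<delta>: "\<delta> > 0" "\<And>x y. a \<le> x \<Longrightarrow> x \<le> y \<Longrightarrow> y \<le> b \<Longrightarrow> y - x < \<delta> \<Longrightarrow>
      \<bar>G y - G x - integral {x..y} g\<bar> \<le> \<epsilon> * integral {x..y} w" by blast
    show "\<exists>\<delta>>0. \<forall>x y. c \<le> x \<longrightarrow> x \<le> y \<longrightarrow> y \<le> d \<longrightarrow> y - x < \<delta> \<longrightarrow>
      \<bar>(G y - integral {c..y} g) - (G x - integral {c..x} g)\<bar>
        \<le> \<epsilon> * (integral {c..y} w - integral {c..x} w)"
    proof (intro exI conjI allI impI, rule \<delta>(1))
      fix x y assume xy: "c \<le> x" "x \<le> y" "y \<le> d" "y - x < \<delta>"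
      have "\<bar>G y - G x - integral {x..y} g\<bar> \<le> \<epsilon> * integral {x..y} w"
        using xy cd by (intro \<delta>(2)) auto
      moreover have "(G y - integral {c..y} g) - (G x - integral {c..x} g) = G y - G x - integral {x..y} g"
        using split[OF g xy(1-3)] by simp
      ultimately show "\<bar>(G y - integral {c..y} g) - (G x - integral {c..x} g)\<bar>
        \<le> \<epsilon> * (integral {c..y} w - integral {c..x} w)" using split[OF w xy(1-3)] by simp
    qed
  qed
  then have "integral {c..d} g = G d - G c" by simp
  then show "(g has_integral G d - G c) {c..d}"
    using int[OF g, of c d] by (simp add: has_integral_integrable_integral)
qed

lemma absolutely_integrable_continuous_times:
  fixes f g :: "real \<Rightarrow> real"
  assumes f: "continuous_on {a..b} f" and g: "g absolutely_integrable_on {a..b}"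
  shows "(\<lambda>x. f x * g x) absolutely_integrable_on {a..b}"
  by (rule absolutely_integrable_bounded_measurable_product_real[OF
        continuous_imp_measurable_on_sets_lebesgue[OF f] _ _ g])
     (use compact_imp_bounded[OF compact_continuous_image[OF f]] in auto)

text \<open>On a short interval \<open>{x..y}\<close> the increment of \<open>p q\<close> is \<open>p y (q y - q x) + q x (p y - p x)\<close>. It is
  the integral of \<open>p y q' + q x p'\<close>, which differs from \<open>p q' + q p'\<close> by the oscillation of \<open>p\<close> and
  \<open>q\<close> only.\<close>

lemma primitive_on_mult:
  assumes p: "primitive_on a b p p'" and q: "primitive_on a b q q'"
  shows "primitive_on a b (\<lambda>x. p x * q x) (\<lambda>x. p x * q' x + q x * p' x)"
proof (rule primitive_onI_local)
  note cp = primitive_on_continuous[OF p] and cq = primitive_on_continuous[OF q]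
  have ip: "p' absolutely_integrable_on {a..b}" and iq: "q' absolutely_integrable_on {a..b}"
    using p q by (auto simp: primitive_on_def)
  show "(\<lambda>x. p x * q' x + q x * p' x) absolutely_integrable_on {a..b}"
    by (intro set_integral_add absolutely_integrable_continuous_times cp cq ip iq)
  show "(\<lambda>x. \<bar>q' x\<bar> + \<bar>p' x\<bar>) absolutely_integrable_on {a..b}"
    by (intro set_integral_add set_integrable_abs ip iq)
  fix \<epsilon> :: real assume \<epsilon>: "0 < \<epsilon>"
  obtain \<delta>1 where \<delta>1: "0 < \<delta>1"
    "\<And>x y s t. \<lbrakk>a \<le> x; y \<le> b; y - x < \<delta>1; s \<in> {x..y}; t \<in> {x..y}\<rbrakk> \<Longrightarrow> \<bar>p s - p t\<bar> \<le> \<epsilon>"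
    using uniform_modulus[OF cp \<epsilon>] by blast
  obtain \<delta>2 where \<delta>2: "0 < \<delta>2"
    "\<And>x y s t. \<lbrakk>a \<le> x; y \<le> b; y - x < \<delta>2; s \<in> {x..y}; t \<in> {x..y}\<rbrakk> \<Longrightarrow> \<bar>q s - q t\<bar> \<le> \<epsilon>"
    using uniform_modulus[OF cq \<epsilon>] by blast
  show "\<exists>\<delta>>0. \<forall>x y. a \<le> x \<longrightarrow> x \<le> y \<longrightarrow> y \<le> b \<longrightarrow> y - x < \<delta> \<longrightarrow>
      \<bar>p y * q y - p x * q x - integral {x..y} (\<lambda>x. p x * q' x + q x * p' x)\<bar>
        \<le> \<epsilon> * integral {x..y} (\<lambda>x. \<bar>q' x\<bar> + \<bar>p' x\<bar>)"
  proof (intro exI[of _ "min \<delta>1 \<delta>2"] conjI allI impI)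
    fix x y assume xy: "a \<le> x" "x \<le> y" "y \<le> b" "y - x < min \<delta>1 \<delta>2"
    note P = primitive_onD[OF p xy(1-3)] and Q = primitive_onD[OF q xy(1-3)]
    have cp': "continuous_on {x..y} p" and cq': "continuous_on {x..y} q"
      using xy by (auto intro: continuous_on_subset[OF cp] continuous_on_subset[OF cq])
    have g: "(\<lambda>r. p r * q' r + q r * p' r) absolutely_integrable_on {x..y}"
      by (intro set_integral_add absolutely_integrable_continuous_times cp' cq' P Q)
    have "((\<lambda>r. (p y * q' r + q x * p' r) - (p r * q' r + q r * p' r)) has_integral
        (p y * (q y - q x) + q x * (p y - p x)) - integral {x..y} (\<lambda>r. p r * q' r + q r * p' r)) {x..y}"
      by (intro has_integral_diff has_integral_add has_integral_mult_right P Q integrable_integral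
          set_lebesgue_integral_eq_integral(1)[OF g])
    then have hi: "((\<lambda>r. (p y - p r) * q' r + (q x - q r) * p' r) has_integral
        (p y * q y - p x * q x - integral {x..y} (\<lambda>r. p r * q' r + q r * p' r))) {x..y}"
      by (simp add: algebra_simps)
    have hw: "(\<lambda>r. \<bar>q' r\<bar> + \<bar>p' r\<bar>) integrable_on {x..y}"
      using P(2) Q(2) by (intro set_lebesgue_integral_eq_integral(1) set_integral_add set_integrable_abs)
    have "norm (integral {x..y} (\<lambda>r. (p y - p r) * q' r + (q x - q r) * p' r))
        \<le> integral {x..y} (\<lambda>r. \<epsilon> * (\<bar>q' r\<bar> + \<bar>p' r\<bar>))"
    proof (rule integral_norm_bound_integral)
      show "(\<lambda>r. (p y - p r) * q' r + (q x - q r) * p' r) integrable_on {x..y}" using hi by blast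
      show "(\<lambda>r. \<epsilon> * (\<bar>q' r\<bar> + \<bar>p' r\<bar>)) integrable_on {x..y}"
        using hw by (rule integrable_on_mult_right)
      fix r assume r: "r \<in> {x..y}"
      have "\<bar>(p y - p r) * q' r\<bar> \<le> \<epsilon> * \<bar>q' r\<bar>" "\<bar>(q x - q r) * p' r\<bar> \<le> \<epsilon> * \<bar>p' r\<bar>"
        unfolding abs_mult using xy r
        by (auto intro!: mult_right_mono \<delta>1(2)[of x y] \<delta>2(2)[of x y])
      then show "norm ((p y - p r) * q' r + (q x - q r) * p' r) \<le> \<epsilon> * (\<bar>q' r\<bar> + \<bar>p' r\<bar>)"
        by (simp add: distrib_left)
    qed
    then show "\<bar>p y * q y - p x * q x - integral {x..y} (\<lambda>x. p x * q' x + q x * p' x)\<bar>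
        \<le> \<epsilon> * integral {x..y} (\<lambda>x. \<bar>q' x\<bar> + \<bar>p' x\<bar>)"
      using integral_unique[OF hi] by simp
  qed (use \<delta>1 \<delta>2 in auto)
qed

text \<open>By the mean value theorem for \<open>F\<close> and the intermediate value theorem for \<open>u\<close>, the increment of
  \<open>F u\<close> over \<open>{x..y}\<close> is \<open>F' (u \<eta>)\<close> times the increment of \<open>u\<close> for some \<open>\<eta>\<close> in \<open>{x..y}\<close>. The
  uniform continuity of \<open>F' u\<close> bounds the error.\<close>

lemma primitive_on_compose:
  assumes u: "primitive_on a b u v"
    and F: "\<And>t. (F has_real_derivative F' t) (at t)" and F': "continuous_on UNIV F'"
  shows "primitive_on a b (\<lambda>x. F (u x)) (\<lambda>x. F' (u x) * v x)"
proof (rule primitive_onI_local)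
  note cu = primitive_on_continuous[OF u]
  have cc: "continuous_on {a..b} (\<lambda>x. F' (u x))"
    by (rule continuous_on_compose2[OF F' cu]) simp
  have iv: "v absolutely_integrable_on {a..b}" using u by (simp add: primitive_on_def)
  show "(\<lambda>x. F' (u x) * v x) absolutely_integrable_on {a..b}"
    by (rule absolutely_integrable_continuous_times[OF cc iv])
  show "(\<lambda>x. \<bar>v x\<bar>) absolutely_integrable_on {a..b}" by (rule set_integrable_abs[OF iv])
  fix \<epsilon> :: real assume \<epsilon>: "0 < \<epsilon>"
  obtain \<delta> where \<delta>: "0 < \<delta>"
    "\<And>x y s t. \<lbrakk>a \<le> x; y \<le> b; y - x < \<delta>; s \<in> {x..y}; t \<in> {x..y}\<rbrakk> \<Longrightarrow> \<bar>F' (u s) - F' (u t)\<bar> \<le> \<epsilon>"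
    using uniform_modulus[OF cc \<epsilon>] by blast
  show "\<exists>\<delta>>0. \<forall>x y. a \<le> x \<longrightarrow> x \<le> y \<longrightarrow> y \<le> b \<longrightarrow> y - x < \<delta> \<longrightarrow>
      \<bar>F (u y) - F (u x) - integral {x..y} (\<lambda>x. F' (u x) * v x)\<bar> \<le> \<epsilon> * integral {x..y} (\<lambda>x. \<bar>v x\<bar>)"
  proof (intro exI[of _ \<delta>] conjI allI impI \<delta>(1))
    fix x y assume xy: "a \<le> x" "x \<le> y" "y \<le> b" "y - x < \<delta>"
    note V = primitive_onD[OF u xy(1-3)]
    have cu': "continuous_on {x..y} u" using xy by (auto intro: continuous_on_subset[OF cu])
    obtain \<eta> where \<eta>: "\<eta> \<in> {x..y}" "F (u y) - F (u x) = F' (u \<eta>) * (u y - u x)"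
    proof -
      consider "u x = u y" | "u x < u y" | "u y < u x" by linarith
      then show thesis
      proof cases
        case 1 then show ?thesis using that[of x] xy by simp
      next
        case 2
        obtain z where z: "u x < z" "z < u y" "F (u y) - F (u x) = (u y - u x) * F' z"
          using MVT2[OF 2] F by metis
        obtain \<eta> where "x \<le> \<eta>" "\<eta> \<le> y" "u \<eta> = z"
          using IVT'[of u x z y] z xy cu' by auto
        then show ?thesis using that[of \<eta>] z by (simp add: mult.commute)
      next
        case 3
        obtain z where z: "u y < z" "z < u x" "F (u x) - F (u y) = (u x - u y) * F' z"
          using MVT2[OF 3] F by metis
        obtain \<eta> where "x \<le> \<eta>" "\<eta> \<le> y" "u \<eta> = z"
          using IVT2'[of u y z x] z xy cu' by auto
        then show ?thesis using that[of \<eta>] z by (simp add: algebra_simps)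
      qed
    qed
    have g: "(\<lambda>r. F' (u r) * v r) integrable_on {x..y}"
      by (rule set_lebesgue_integral_eq_integral(1)[OF absolutely_integrable_continuous_times[OF _ V(2)]])
         (use xy in \<open>auto intro: continuous_on_subset[OF cc]\<close>)
    have "((\<lambda>r. F' (u \<eta>) * v r - F' (u r) * v r) has_integral
        F' (u \<eta>) * (u y - u x) - integral {x..y} (\<lambda>r. F' (u r) * v r)) {x..y}"
      by (intro has_integral_diff has_integral_mult_right V integrable_integral g)
    then have hi: "((\<lambda>r. (F' (u \<eta>) - F' (u r)) * v r) has_integral
        F (u y) - F (u x) - integral {x..y} (\<lambda>r. F' (u r) * v r)) {x..y}"
      by (simp add: \<eta>(2) left_diff_distrib)
    have "norm (integral {x..y} (\<lambda>r. (F' (u \<eta>) - F' (u r)) * v r)) \<le> integral {x..y} (\<lambda>r. \<epsilon> * \<bar>v r\<bar>)"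
    proof (rule integral_norm_bound_integral)
      show "(\<lambda>r. (F' (u \<eta>) - F' (u r)) * v r) integrable_on {x..y}" using hi by blast
      show "(\<lambda>r. \<epsilon> * \<bar>v r\<bar>) integrable_on {x..y}"
        by (intro integrable_on_mult_right set_lebesgue_integral_eq_integral(1) set_integrable_abs V)
      fix r assume r: "r \<in> {x..y}"
      then show "norm ((F' (u \<eta>) - F' (u r)) * v r) \<le> \<epsilon> * \<bar>v r\<bar>"
        using \<delta>(2)[OF xy(1,3,4) \<eta>(1) r] by (simp add: abs_mult mult_right_mono)
    qed
    then show "\<bar>F (u y) - F (u x) - integral {x..y} (\<lambda>x. F' (u x) * v x)\<bar> \<le> \<epsilon> * integral {x..y} (\<lambda>x. \<bar>v x\<bar>)"
      using integral_unique[OF hi] by simp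
  qed
qed

lemma primitive_on_C1:
  assumes "\<And>x. x \<in> {a..b} \<Longrightarrow> (p has_real_derivative p' x) (at x)" "continuous_on {a..b} p'"
  shows "primitive_on a b p p'"
  unfolding primitive_on_def
proof (intro conjI allI impI absolutely_integrable_continuous_real assms(2))
  fix x y assume "a \<le> x" "x \<le> y" "y \<le> b"
  then have "(p has_vector_derivative p' t) (at t within {x..y})" if "t \<in> {x..y}" for t
    using assms(1)[of t] that
    by (simp add: has_real_derivative_iff_has_vector_derivative has_vector_derivative_at_within)
  then show "(p' has_integral p y - p x) {x..y}"
    using \<open>x \<le> y\<close> by (intro fundamental_theorem_of_calculus)
qed

section \<open>Functions of regular growth\<close>

text \<open>The tangent inequality bounds \<open>f' y\<close> by difference quotients of \<open>f\<close> at \<open>y\<close> with a fixed step \<open>h\<close>.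
  These are continuous in \<open>y\<close>, and at \<open>y = x\<close> they are close to \<open>f' x\<close> for small \<open>h\<close> of either
  sign.\<close>

lemma convex_derivative_continuous:
  fixes f :: "real \<Rightarrow> real"
  assumes conv: "convex_on UNIV f" and D: "\<And>x. (f has_real_derivative f' x) (at x)"
  shows "continuous_on UNIV f'"
proof (rule continuous_at_imp_continuous_on, rule ballI)
  fix x
  have tangent: "f' y * h \<le> f (y + h) - f y" for y h
    using convex_on_imp_above_tangent[OF conv _ _ _ D[of y], of "y + h"] by simp
  have "isCont f y" for y using D DERIV_isCont by blast
  then have cont: "((\<lambda>y. (f (y + h) - f y) / h) \<longlongrightarrow> (f (x + h) - f x) / h) (at x)" if "h \<noteq> 0" for h
  proof -
    have "isCont (\<lambda>y. f (y + h)) x"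
      by (rule isCont_o2[of x "\<lambda>y. y + h" f]) (simp_all add: \<open>\<And>y. isCont f y\<close>)
    then have "isCont (\<lambda>y. (f (y + h) - f y) / h) x"
      using that \<open>\<And>y. isCont f y\<close> by (intro continuous_intros) auto
    then show ?thesis by (simp add: isCont_def)
  qed
  have lim: "((\<lambda>h. (f (x + h) - f x) / h) \<longlongrightarrow> f' x) (at 0)"
    using D by (simp add: DERIV_def)
  have "(f' \<longlongrightarrow> f' x) (at x)"
  proof (rule order_tendstoI)
    fix l assume "f' x < l"
    with lim have "\<forall>\<^sub>F h in at_right 0. (f (x + h) - f x) / h < l"
      using order_tendstoD(2) eventually_at_split by blast
    moreover have "\<forall>\<^sub>F h::real in at_right 0. 0 < h" by (simp add: eventually_at_right_less)
    ultimately have "\<forall>\<^sub>F h in at_right 0. 0 < h \<and> (f (x + h) - f x) / h < l" by eventually_elim simp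
    then obtain h where h: "0 < h" "(f (x + h) - f x) / h < l"
      using eventually_happens'[OF trivial_limit_at_right_real] by blast
    have "\<forall>\<^sub>F y in at x. (f (y + h) - f y) / h < l"
      using order_tendstoD(2)[OF cont h(2)] h(1) by simp
    then show "\<forall>\<^sub>F y in at x. f' y < l"
    proof eventually_elim
      case (elim y)
      have "f' y \<le> (f (y + h) - f y) / h" using tangent[of y h] h by (simp add: field_simps)
      then show ?case using elim by simp
    qed
  next
    fix l assume "l < f' x"
    with lim have "\<forall>\<^sub>F h in at_left 0. l < (f (x + h) - f x) / h"
      using order_tendstoD(1) eventually_at_split by blast
    moreover have "\<forall>\<^sub>F h::real in at_left 0. h < 0" by (simp add: eventually_at_filter)
    ultimately have "\<forall>\<^sub>F h in at_left 0. h < 0 \<and> l < (f (x + h) - f x) / h" by eventually_elim simp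
    then obtain h where h: "h < 0" "l < (f (x + h) - f x) / h"
      using eventually_happens'[OF trivial_limit_at_left_real] by blast
    have "\<forall>\<^sub>F y in at x. l < (f (y + h) - f y) / h"
      using order_tendstoD(1)[OF cont h(2)] h(1) by simp
    then show "\<forall>\<^sub>F y in at x. l < f' y"
    proof eventually_elim
      case (elim y)
      have "(f (y + h) - f y) / h \<le> f' y" using tangent[of y h] h by (simp add: field_simps)
      then show ?case using elim by simp
    qed
  qed
  then show "isCont f' x" by (simp add: isCont_def)
qed

locale growth_function =
  fixes M :: "real \<Rightarrow> real" and d D :: real
  assumes N: "N_function M" and M_diff: "M differentiable_on {0..}"
    and d_ge_1: "1 \<le> d" and d_le_D: "d \<le> D"
    and growth: "\<And>x. 0 < x \<Longrightarrow> d * (M x / x) \<le> deriv M x \<and> deriv M x \<le> D * (M x / x)"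
begin

text \<open>The even extension turns \<open>M\<close> into a function on the whole line, to which the chain rule applies
  without regard to the sign of the argument.\<close>

definition \<Phi> :: "real \<Rightarrow> real" where "\<Phi> t = M \<bar>t\<bar>"

text \<open>The factor \<open>sgn t\<close> makes the value at \<open>0\<close> equal to \<open>0\<close>, whatever \<open>deriv M 0\<close> is: that derivative
  is two-sided and depends on arbitrary values of \<open>M\<close> at negative arguments.\<close>

definition \<Phi>' :: "real \<Rightarrow> real" where "\<Phi>' t = sgn t * deriv M \<bar>t\<bar>"

lemma D_ge_1: "1 \<le> D" using d_ge_1 d_le_D by simp

lemma M_nonneg: "0 \<le> x \<Longrightarrow> 0 \<le> M x" using N by (simp add: N_function_def)

lemma \<Phi>_nonneg [simp]: "0 \<le> \<Phi> t" by (simp add: \<Phi>_def M_nonneg)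

lemma \<Phi>_minus [simp]: "\<Phi> (- t) = \<Phi> t" by (simp add: \<Phi>_def)

lemma \<Phi>_abs [simp]: "\<Phi> \<bar>t\<bar> = \<Phi> t" by (simp add: \<Phi>_def)

lemma M_0: "M 0 = 0"
proof -
  have "((\<lambda>x. M x / x * x) \<longlongrightarrow> 0 * 0) (at_right 0)"
    using N by (intro tendsto_mult tendsto_ident_at) (simp add: N_function_def)
  moreover have "\<forall>\<^sub>F x in at_right 0. M x / x * x = M x"
    by (simp add: eventually_at_filter)
  ultimately have "(M \<longlongrightarrow> 0) (at_right 0)" by (simp add: tendsto_cong)
  moreover have "(M \<longlongrightarrow> M 0) (at_right 0)"
  proof (rule tendsto_within_subset)
    show "(M \<longlongrightarrow> M 0) (at 0 within {0..})"
      using N by (simp add: N_function_def continuous_on_def)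
  qed auto
  ultimately show ?thesis using tendsto_unique[OF trivial_limit_at_right_real] by blast
qed

lemma \<Phi>_0 [simp]: "\<Phi> 0 = 0" by (simp add: \<Phi>_def M_0)

lemma M_DERIV: "0 < x \<Longrightarrow> (M has_real_derivative deriv M x) (at x)"
proof -
  assume x: "0 < x"
  have "M differentiable (at x within {0..})"
    using M_diff x by (simp add: differentiable_on_def)
  then have "M differentiable (at x within {0<..})"
    by (rule differentiable_within_subset) auto
  moreover have "at x within {0<..} = at x"
    using x by (intro at_within_open) auto
  ultimately show ?thesis by (metis DERIV_deriv_iff_real_differentiable)
qed

lemma \<Phi>_sublinear_at_0:
  assumes "0 < \<epsilon>"
  obtains \<delta> where "0 < \<delta>" "\<And>t. \<bar>t\<bar> < \<delta> \<Longrightarrow> \<Phi> t \<le> \<epsilon> * \<bar>t\<bar>"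
proof -
  have "\<forall>\<^sub>F x in at_right 0. M x / x < \<epsilon>"
    using order_tendstoD(2)[of "\<lambda>x. M x / x" 0 "at_right 0" \<epsilon>] N assms by (simp add: N_function_def)
  then obtain \<delta> where \<delta>: "0 < \<delta>" "\<And>x. 0 < x \<Longrightarrow> x < \<delta> \<Longrightarrow> M x / x < \<epsilon>"
    unfolding eventually_at_right_field by metis
  show thesis
  proof (rule that[OF \<delta>(1)])
    fix t assume "\<bar>t\<bar> < \<delta>"
    then show "\<Phi> t \<le> \<epsilon> * \<bar>t\<bar>"
      using \<delta>(2)[of "\<bar>t\<bar>"] M_0 by (cases "t = 0") (auto simp: \<Phi>_def field_simps)
  qed
qed

lemma \<Phi>_DERIV: "(\<Phi> has_real_derivative \<Phi>' t) (at t)"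
proof -
  consider "t = 0" | "0 < t" | "t < 0" by linarith
  then show ?thesis
  proof cases
    case 1
    have "((\<lambda>h. (\<Phi> (0 + h) - \<Phi> 0) / h) \<longlongrightarrow> 0) (at 0)"
    proof (rule tendstoI)
      fix e :: real assume e: "0 < e"
      obtain \<delta> where \<delta>: "0 < \<delta>" "\<And>t. \<bar>t\<bar> < \<delta> \<Longrightarrow> \<Phi> t \<le> e / 2 * \<bar>t\<bar>"
        using \<Phi>_sublinear_at_0[of "e / 2"] e by auto
      have "dist ((\<Phi> (0 + h) - \<Phi> 0) / h) 0 < e" if "h \<noteq> 0" "\<bar>h\<bar> < \<delta>" for h
      proof -
        have "\<Phi> h < e * \<bar>h\<bar>" using \<delta>(2)[OF that(2)] mult_pos_pos[OF e, of "\<bar>h\<bar>"] that(1) by simp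
        then show ?thesis using that by (simp add: field_simps)
      qed
      then show "\<forall>\<^sub>F h in at 0. dist ((\<Phi> (0 + h) - \<Phi> 0) / h) 0 < e"
        using \<delta>(1) unfolding eventually_at by (intro exI[of _ \<delta>]) auto
    qed
    then show ?thesis using 1 by (simp add: DERIV_def \<Phi>'_def)
  next
    case 2
    have "(\<Phi> has_real_derivative deriv M t) (at t)"
      by (rule has_field_derivative_transform_within_open[OF M_DERIV[OF 2], of "{0<..}"])
         (use 2 in \<open>auto simp: \<Phi>_def\<close>)
    then show ?thesis using 2 by (simp add: \<Phi>'_def)
  next
    case 3
    have "((\<lambda>x. M (- x)) has_real_derivative deriv M (- t) * (- 1)) (at t)"
      by (rule DERIV_chain2[OF M_DERIV]) (use 3 in \<open>auto intro!: derivative_eq_intros\<close>)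
    then have "(\<Phi> has_real_derivative deriv M (- t) * (- 1)) (at t)"
      by (rule has_field_derivative_transform_within_open[of _ _ _ "{..<0}"])
         (use 3 in \<open>auto simp: \<Phi>_def\<close>)
    then show ?thesis using 3 by (simp add: \<Phi>'_def)
  qed
qed

lemma \<Phi>_continuous: "continuous_on S \<Phi>"
  by (intro continuous_at_imp_continuous_on ballI DERIV_isCont[OF \<Phi>_DERIV])

lemma \<Phi>'_growth: "d * \<Phi> t \<le> \<Phi>' t * t" "\<Phi>' t * t \<le> D * \<Phi> t"
proof -
  have eq: "\<Phi>' t * t = deriv M \<bar>t\<bar> * \<bar>t\<bar>" by (simp add: \<Phi>'_def abs_sgn mult.commute mult.left_commute)
  show "d * \<Phi> t \<le> \<Phi>' t * t" "\<Phi>' t * t \<le> D * \<Phi> t"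
    unfolding eq using growth[of "\<bar>t\<bar>"] by (cases "t = 0"; simp add: \<Phi>_def M_0 field_simps)+
qed

lemma M_mono: "0 \<le> x \<Longrightarrow> x \<le> y \<Longrightarrow> M x \<le> M y"
proof -
  assume xy: "0 \<le> x" "x \<le> y"
  have "\<Phi> x \<le> \<Phi> y"
  proof (rule DERIV_nonneg_imp_nondecreasing[OF xy(2)])
    fix t assume "x \<le> t"
    then have "0 \<le> \<Phi>' t"
      using growth[of t] M_nonneg[of t] d_ge_1 xy
      by (cases "t = 0") (auto simp: \<Phi>'_def intro: order.trans[rotated])
    then show "\<exists>y. (\<Phi> has_real_derivative y) (at t) \<and> 0 \<le> y" using \<Phi>_DERIV by blast
  qed
  then show ?thesis using xy by (simp add: \<Phi>_def)
qed

lemma \<Phi>_mono: "\<bar>s\<bar> \<le> \<bar>t\<bar> \<Longrightarrow> \<Phi> s \<le> \<Phi> t"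
  by (simp add: \<Phi>_def M_mono)

lemma \<Phi>_convex: "convex_on UNIV \<Phi>"
proof (rule convex_onI)
  fix t x y :: real assume t: "0 < t" "t < 1"
  have "\<Phi> ((1 - t) *\<^sub>R x + t *\<^sub>R y) \<le> M ((1 - t) *\<^sub>R \<bar>x\<bar> + t *\<^sub>R \<bar>y\<bar>)"
    unfolding \<Phi>_def
  proof (rule M_mono)
    have "\<bar>(1 - t) * x + t * y\<bar> \<le> \<bar>(1 - t) * x\<bar> + \<bar>t * y\<bar>" by (rule abs_triangle_ineq)
    then show "\<bar>(1 - t) *\<^sub>R x + t *\<^sub>R y\<bar> \<le> (1 - t) *\<^sub>R \<bar>x\<bar> + t *\<^sub>R \<bar>y\<bar>"
      using t by (simp add: abs_mult)
  qed simp
  also have "\<dots> \<le> (1 - t) * M \<bar>x\<bar> + t * M \<bar>y\<bar>"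
    using N t by (intro convex_onD[of "{0..}"]) (auto simp: N_function_def)
  finally show "\<Phi> ((1 - t) *\<^sub>R x + t *\<^sub>R y) \<le> (1 - t) * \<Phi> x + t * \<Phi> y" by (simp add: \<Phi>_def)
qed simp

lemma \<Phi>'_continuous: "continuous_on UNIV \<Phi>'"
  by (rule convex_derivative_continuous[OF \<Phi>_convex \<Phi>_DERIV])

text \<open>The tangent inequality at \<open>t\<close>, evaluated at \<open>s\<close> or \<open>- s\<close>, combined with
  \<open>t \<Phi>'(t) - \<Phi>(t) \<le> (D - 1) \<Phi>(t)\<close>.\<close>

lemma young: "\<bar>\<Phi>' t\<bar> * \<bar>s\<bar> \<le> \<Phi> s + (D - 1) * \<Phi> t"
proof -
  define x where "x = sgn (\<Phi>' t) * \<bar>s\<bar>"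
  have "\<Phi> x = \<Phi> s \<or> \<Phi>' t = 0" by (auto simp: x_def sgn_if)
  moreover have "\<Phi>' t * (x - t) \<le> \<Phi> x - \<Phi> t"
    using convex_on_imp_above_tangent[OF \<Phi>_convex _ _ _ \<Phi>_DERIV, of t x] by simp
  moreover have "\<Phi>' t * x = \<bar>\<Phi>' t\<bar> * \<bar>s\<bar>" by (auto simp: x_def sgn_if)
  ultimately have "\<Phi>' t \<noteq> 0 \<Longrightarrow> ?thesis"
    using \<Phi>'_growth(2)[of t] by (auto simp: algebra_simps)
  moreover have "0 \<le> \<Phi> s + (D - 1) * \<Phi> t" using D_ge_1 by simp
  ultimately show ?thesis by fastforce
qed

lemma \<Phi>'_ge: "\<Phi> t \<le> \<bar>\<Phi>' t\<bar> * \<bar>t\<bar>"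
proof -
  have "1 * \<Phi> t \<le> d * \<Phi> t" using d_ge_1 by (intro mult_right_mono) auto
  also have "\<dots> \<le> \<Phi>' t * t" by (rule \<Phi>'_growth)
  also have "\<dots> \<le> \<bar>\<Phi>' t\<bar> * \<bar>t\<bar>" by (simp add: flip: abs_mult)
  finally show ?thesis by simp
qed

lemma c_pos: "0 < l \<Longrightarrow> 0 < c d D l" by (simp add: c_def less_max_iff_disj)

lemma c_mono: "0 \<le> k \<Longrightarrow> k \<le> l \<Longrightarrow> c d D k \<le> c d D l"
  unfolding c_def using d_ge_1 d_le_D by (intro max.mono powr_mono2) auto

lemma c_ge: "0 < l \<Longrightarrow> l \<le> c d D l + 1"
proof (cases "1 \<le> l")
  case True
  then have "l powr 1 \<le> l powr d" using d_ge_1 by (intro powr_mono) auto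
  then show ?thesis using True by (simp add: c_def)
next
  case False
  moreover assume "0 < l"
  ultimately show ?thesis using c_pos[of l] by simp
qed

text \<open>The growth condition makes \<open>M (l x) l\<^bsup>-D\<^esup>\<close> nonincreasing and \<open>M (l x) l\<^bsup>-d\<^esup>\<close> nondecreasing in \<open>l\<close>;
  compare with \<open>l = 1\<close>, using the first for \<open>l \<ge> 1\<close> and the second for \<open>l < 1\<close>.\<close>

lemma \<Phi>_scale:
  assumes l: "0 < l"
  shows "\<Phi> (l * t) \<le> c d D l * \<Phi> t"
proof (cases "t = 0")
  case True then show ?thesis by simp
next
  case False
  define x where "x = \<bar>t\<bar>"
  have x: "0 < x" using False by (simp add: x_def)
  have der: "((\<lambda>l. M (l * x) * l powr (- a)) has_real_derivative
      (deriv M (l * x) * (l * x) - a * M (l * x)) * l powr (- a - 1)) (at l)" if "0 < l" for a l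
  proof -
    have "((\<lambda>l. M (l * x)) has_real_derivative deriv M (l * x) * x) (at l)"
      by (rule DERIV_chain2[OF M_DERIV]) (use that x in \<open>auto intro!: derivative_eq_intros\<close>)
    from DERIV_mult[OF this has_real_derivative_powr[OF that, of "- a"]] show ?thesis
      using that by (simp add: powr_diff field_simps)
  qed
  have gr: "d * M (l * x) \<le> deriv M (l * x) * (l * x)" "deriv M (l * x) * (l * x) \<le> D * M (l * x)"
    if "0 < l" for l using growth[of "l * x"] x that by (simp_all add: field_simps)
  have "M (l * x) \<le> c d D l * M x"
  proof (cases "1 \<le> l")
    case True
    have "M (l * x) * l powr (- D) \<le> M (1 * x) * 1 powr (- D)"
    proof (rule DERIV_nonpos_imp_nonincreasing[OF True])
      fix k :: real assume k: "1 \<le> k"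
      then show "\<exists>y. ((\<lambda>l. M (l * x) * l powr (- D)) has_real_derivative y) (at k) \<and> y \<le> 0"
        using gr(2)[of k] k
        by (intro exI[of _ "(deriv M (k * x) * (k * x) - D * M (k * x)) * k powr (- D - 1)"]
            conjI der mult_nonpos_nonneg) auto
    qed
    then have "M (l * x) \<le> l powr D * M x" using l by (simp add: powr_minus field_simps)
    also have "\<dots> \<le> c d D l * M x" using x by (intro mult_right_mono) (auto simp: c_def M_nonneg)
    finally show ?thesis .
  next
    case False
    then have "l \<le> 1" by simp
    then have "M (l * x) * l powr (- d) \<le> M (1 * x) * 1 powr (- d)"
    proof (rule DERIV_nonneg_imp_nondecreasing)
      fix k :: real assume k: "l \<le> k"
      then show "\<exists>y. ((\<lambda>l. M (l * x) * l powr (- d)) has_real_derivative y) (at k) \<and> 0 \<le> y"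
        using gr(1)[of k] k l
        by (intro exI[of _ "(deriv M (k * x) * (k * x) - d * M (k * x)) * k powr (- d - 1)"]
            conjI der mult_nonneg_nonneg) auto
    qed
    then have "M (l * x) \<le> l powr d * M x" using l by (simp add: powr_minus field_simps)
    also have "\<dots> \<le> c d D l * M x" using x by (intro mult_right_mono) (auto simp: c_def M_nonneg)
    finally show ?thesis .
  qed
  then show ?thesis using l by (simp add: \<Phi>_def x_def abs_mult)
qed

end

section \<open>Integration on the half-line\<close>

lemma half_line_exhaustion:
  "(\<lambda>k. indicator {1 / real (Suc k)..real (Suc k)} x * g x) \<longlonglongrightarrow> (g x :: real)" if x: "0 < x" for x
proof -
  obtain N where N: "max x (1 / x) < real N" using reals_Archimedean2 by blast
  have "\<forall>\<^sub>F k in sequentially. indicator {1 / real (Suc k)..real (Suc k)} x * g x = g x"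
    using eventually_ge_at_top[of N]
  proof eventually_elim
    case (elim k)
    then have "x \<le> real (Suc k)" "1 / x \<le> real (Suc k)" using N by auto
    then have "x \<in> {1 / real (Suc k)..real (Suc k)}" using x by (simp add: field_simps)
    then show ?case by simp
  qed
  then show ?thesis by (rule tendsto_eventually)
qed

lemma locally_integrable_measurable:
  fixes v :: "real \<Rightarrow> real"
  assumes "\<And>a b. 0 < a \<Longrightarrow> a \<le> b \<Longrightarrow> v absolutely_integrable_on {a..b}"
  shows "v \<in> borel_measurable (lebesgue_on {0<..})"
proof (rule borel_measurable_LIMSEQ_real)
  show "(\<lambda>k. indicator {1 / real (Suc k)..real (Suc k)} x * v x) \<longlonglongrightarrow> v x"
    if "x \<in> space (lebesgue_on {0<..})" for x
    by (rule half_line_exhaustion) (use that in simp)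
  have "1 / real (Suc k) \<le> real (Suc k)" for k
    by (rule order.trans[of _ 1]) auto
  then have "integrable (lebesgue_on {0<..}) (\<lambda>x. indicator {1 / real (Suc k)..real (Suc k)} x * v x)" for k
    by (intro integrable_indicator_interval assms) auto
  then show "(\<lambda>x. indicator {1 / real (Suc k)..real (Suc k)} x * v x) \<in> borel_measurable (lebesgue_on {0<..})" for k
    by auto
qed

text \<open>Monotone convergence along the intervals \<open>{1 / (k + 1)..k + 1}\<close>, which exhaust the half-line.\<close>

lemma half_line_integrable_if_bounded:
  fixes g :: "real \<Rightarrow> real"
  assumes nonneg: "\<And>x. 0 \<le> g x"
    and loc: "\<And>a b. 0 < a \<Longrightarrow> a \<le> b \<Longrightarrow> g absolutely_integrable_on {a..b}"
    and bound: "\<And>a b. 0 < a \<Longrightarrow> a \<le> b \<Longrightarrow> integral {a..b} g \<le> C"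
  shows "g absolutely_integrable_on {0<..}" "integral {0<..} g \<le> C"
proof -
  define I where "I k = {1 / real (Suc k)..real (Suc k)}" for k
  define f where "f k x = indicator (I k) x * g x" for k x
  have le: "0 < 1 / real (Suc k)" "1 / real (Suc k) \<le> real (Suc k)" for k
    by (auto intro: order.trans[of _ 1])
  have hi: "(f k has_integral integral (I k) g) {0<..}" for k
  proof -
    have "(g has_integral integral (I k) g) (I k)"
      unfolding I_def by (intro integrable_integral set_lebesgue_integral_eq_integral(1) loc le)
    moreover have "I k \<subseteq> {0<..}"
      using less_le_trans[OF le(1)[of k]] unfolding I_def by (metis atLeastAtMost_iff greaterThan_iff subsetI)
    moreover have "f k = (\<lambda>x. if x \<in> I k then g x else 0)"
      by (auto simp: f_def)
    ultimately show ?thesis by (simp add: has_integral_restrict)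
  qed
  have lim: "(\<lambda>k. f k x) \<longlonglongrightarrow> g x" if "x \<in> {0<..}" for x
    unfolding f_def I_def by (rule half_line_exhaustion) (use that in simp)
  have fle: "integral {0<..} (f k) \<le> C" for k
    using integral_unique[OF hi] bound[OF le] by (simp add: I_def)
  have fge: "0 \<le> integral {0<..} (f k)" for k
    using hi by (intro integral_nonneg) (auto simp: f_def nonneg)
  have "g integrable_on {0<..} \<and> (\<lambda>k. integral {0<..} (f k)) \<longlonglongrightarrow> integral {0<..} g"
  proof (rule monotone_convergence_increasing)
    show "f k integrable_on {0<..}" for k using hi by blast
    have "I k \<subseteq> I (Suc k)" for k
      unfolding I_def by (intro atLeastatMost_subset_iff[THEN iffD2] disjI2 conjI frac_le) auto
    then show "f k x \<le> f (Suc k) x" for k x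
      unfolding f_def using nonneg[of x] by (auto simp: indicator_def)
    show "bounded (range (\<lambda>k. integral {0<..} (f k)))"
      using fle fge by (auto simp: bounded_real intro!: exI[of _ C])
  qed (rule lim)
  then show "g absolutely_integrable_on {0<..}" "integral {0<..} g \<le> C"
    using fle nonneg by (auto intro!: nonnegative_absolutely_integrable_1 LIMSEQ_le_const2)
qed

lemma half_line_integral_Icc:
  fixes g :: "real \<Rightarrow> real"
  assumes g: "g absolutely_integrable_on {0<..}" and nonneg: "\<And>x. 0 \<le> g x" and a: "0 < a"
  shows "g absolutely_integrable_on {a..b}" "integral {a..b} g \<le> integral {0<..} g"
proof -
  show ab: "g absolutely_integrable_on {a..b}"
    by (rule set_integrable_subset[OF g]) (use a in auto)
  show "integral {a..b} g \<le> integral {0<..} g"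
    by (rule integral_subset_le)
       (use a nonneg in \<open>auto intro: set_lebesgue_integral_eq_integral(1)[OF g]
          set_lebesgue_integral_eq_integral(1)[OF ab]\<close>)
qed

lemma small_tail:
  fixes g :: "real \<Rightarrow> real"
  assumes g: "g absolutely_integrable_on {0<..}" and nonneg: "\<And>x. 0 \<le> g x" and \<epsilon>: "0 < \<epsilon>"
  obtains N where "1 \<le> N" "\<And>a b. N \<le> a \<Longrightarrow> a \<le> b \<Longrightarrow> integral {a..b} g \<le> \<epsilon>"
proof -
  define S where "S = (SUP x\<in>{1..}. integral {1..x} g)"
  note Icc = half_line_integral_Icc[OF g nonneg]
  have int: "g integrable_on {a..b}" if "0 < a" for a b
    using Icc(1)[OF that] by (rule set_lebesgue_integral_eq_integral(1))
  have bdd: "bdd_above ((\<lambda>x. integral {1..x} g) ` {1..})"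
    using Icc(2)[of 1] by (intro bdd_aboveI2) simp
  have "\<exists>N\<in>{1..}. S - \<epsilon> < integral {1..N} g"
    using less_cSUP_iff[OF _ bdd, of "S - \<epsilon>"] \<epsilon> by (simp add: S_def)
  then obtain N where N: "1 \<le> N" "S - \<epsilon> < integral {1..N} g" by auto
  show thesis
  proof (rule that[OF N(1)])
    fix a b assume ab: "N \<le> a" "a \<le> b"
    have "integral {1..N} g + integral {N..a} g + integral {a..b} g = integral {1..b} g"
      using N ab int[of 1] by (simp add: Henstock_Kurzweil_Integration.integral_combine)
    moreover have "0 \<le> integral {N..a} g" using nonneg int[of N] N by (intro integral_nonneg) auto
    moreover have "integral {1..b} g \<le> S"
      unfolding S_def by (rule cSUP_upper[OF _ bdd]) (use N ab in auto)
    ultimately show "integral {a..b} g \<le> \<epsilon>" using N by simp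
  qed
qed

lemma half_line_nn_integral:
  fixes g :: "real \<Rightarrow> real"
  assumes nonneg: "\<And>x. 0 \<le> g x"
  shows "g absolutely_integrable_on {0<..} \<Longrightarrow>
      (\<integral>\<^sup>+x. ennreal (g x) \<partial>lebesgue_on {0<..}) = ennreal (integral {0<..} g)"
    and "g \<in> borel_measurable (lebesgue_on {0<..}) \<Longrightarrow>
      (\<integral>\<^sup>+x. ennreal (g x) \<partial>lebesgue_on {0<..}) < \<infinity> \<Longrightarrow> g absolutely_integrable_on {0<..}"
proof -
  have iff: "g absolutely_integrable_on {0<..} \<longleftrightarrow> integrable (lebesgue_on {0<..}) g"
    by (simp add: set_integrable_def integrable_restrict_space)
  show "(\<integral>\<^sup>+x. ennreal (g x) \<partial>lebesgue_on {0<..}) = ennreal (integral {0<..} g)"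
    if "g absolutely_integrable_on {0<..}"
    using that nonneg by (simp add: iff nn_integral_eq_integral lebesgue_integral_eq_integral)
  show "g absolutely_integrable_on {0<..}"
    if "g \<in> borel_measurable (lebesgue_on {0<..})" "(\<integral>\<^sup>+x. ennreal (g x) \<partial>lebesgue_on {0<..}) < \<infinity>"
    unfolding iff using that nonneg by (intro integrableI_nonneg) auto
qed

lemma primitive_on_cong:
  assumes "primitive_on a b u v" "\<And>x. x \<in> {a..b} \<Longrightarrow> u x = u' x" "\<And>x. x \<in> {a..b} \<Longrightarrow> v x = v' x"
  shows "primitive_on a b u' v'"
  unfolding primitive_on_def
proof (intro conjI allI impI)
  have "v absolutely_integrable_on {a..b}" using assms(1) by (simp add: primitive_on_def)
  then show "v' absolutely_integrable_on {a..b}"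
    using absolutely_integrable_spike_eq[of "{}" "{a..b}" v v'] assms(3) by simp
  fix x y assume xy: "a \<le> x" "x \<le> y" "y \<le> b"
  have "(v has_integral u' y - u' x) {x..y}"
    using primitive_onD(1)[OF assms(1) xy] assms(2)[of x] assms(2)[of y] xy by simp
  then show "(v' has_integral u' y - u' x) {x..y}"
    by (rule has_integral_eq[rotated]) (use assms(3) xy in auto)
qed

definition primitive_on_half_line :: "(real \<Rightarrow> real) \<Rightarrow> (real \<Rightarrow> real) \<Rightarrow> bool" where
  "primitive_on_half_line u v \<longleftrightarrow> (\<forall>a b. 0 < a \<longrightarrow> a \<le> b \<longrightarrow> primitive_on a b u v)"

lemma W11_loc_primitive:
  assumes "u \<in> W11_loc" "weak_derivative u v"
  shows "primitive_on_half_line u v"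
  unfolding primitive_on_half_line_def primitive_on_def
proof (intro allI impI conjI)
  have cont: "continuous_on {0<..} u"
    using assms(1) by (simp add: W11_loc_def locally_absolutely_continuous_imp_continuous_on)
  fix a b :: real assume ab: "0 < a" "a \<le> b"
  have "locally_integrable v" using assms(2) by (simp add: weak_derivative_def)
  moreover have "compact {a..b}" "{a..b} \<subseteq> {0<..}" using ab by auto
  ultimately show "v absolutely_integrable_on {a..b}" unfolding locally_integrable_def by blast
  show "(v has_integral u y - u x) {x..y}" if "a \<le> x" "x \<le> y" "y \<le> b" for x y
    using that ab by (intro weak_derivative_has_integral[OF assms(2) cont]) auto
qed

lemma primitive_on_half_line_scale:
  assumes "primitive_on_half_line u v"
  shows "primitive_on_half_line (\<lambda>x. k * u x) (\<lambda>x. k * v x)"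
  using assms unfolding primitive_on_half_line_def primitive_on_def
  by (auto simp flip: right_diff_distrib intro!: has_integral_mult_right set_integrable_mult_right)

section \<open>The flux and its increments\<close>

text \<open>Both cases of the theorem are instances, with \<open>\<sigma> = 1\<close> and \<open>\<sigma> = - 1\<close>. The condition \<open>coercive\<close>
  is the lower bound on the zeroth order part of the derivative of \<open>- flux\<close>.\<close>

locale hardy_flux = growth_function +
  fixes \<phi> :: "real \<Rightarrow> real" and \<sigma> b :: real
  assumes \<phi>_diff: "\<And>r. 0 < r \<Longrightarrow> \<phi> differentiable (at r)"
    and \<phi>'_diff: "\<And>r. 0 < r \<Longrightarrow> deriv \<phi> differentiable (at r)"
    and \<phi>''_cont: "continuous_on {0<..} (deriv (deriv \<phi>))"
    and \<phi>'_nonzero: "\<And>r. 0 < r \<Longrightarrow> deriv \<phi> r \<noteq> 0"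
    and \<sigma>: "\<sigma> = 1 \<or> \<sigma> = - 1"
    and b_pos: "0 < b"
    and coercive: "\<And>r t. 0 < r \<Longrightarrow>
      b * \<Phi> t \<le> \<sigma> * (\<Phi> t - curvature_ratio \<phi> r * (\<Phi>' t * t - \<Phi> t))"
begin

definition z :: "(real \<Rightarrow> real) \<Rightarrow> real \<Rightarrow> real" where "z u r = deriv \<phi> r * u r"

definition energy :: "(real \<Rightarrow> real) \<Rightarrow> real \<Rightarrow> real" where "energy f r = \<Phi> (f r) * exp (- \<phi> r)"

definition flux :: "(real \<Rightarrow> real) \<Rightarrow> real \<Rightarrow> real" where
  "flux u r = \<sigma> * exp (- \<phi> r) / deriv \<phi> r * \<Phi> (z u r)"

text \<open>The part of the derivative of the flux that involves \<open>v\<close>, estimated by its absolute value.\<close>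

definition production :: "(real \<Rightarrow> real) \<Rightarrow> (real \<Rightarrow> real) \<Rightarrow> real \<Rightarrow> real" where
  "production u v r = exp (- \<phi> r) * \<bar>\<Phi>' (z u r)\<bar> * \<bar>v r\<bar>"

lemma energy_nonneg [simp]: "0 \<le> energy f r" by (simp add: energy_def)

lemma production_nonneg [simp]: "0 \<le> production u v r" by (simp add: production_def)

lemma \<phi>_DERIV: "0 < r \<Longrightarrow> (\<phi> has_real_derivative deriv \<phi> r) (at r)"
  using \<phi>_diff DERIV_deriv_iff_real_differentiable by blast

lemma \<phi>'_DERIV: "0 < r \<Longrightarrow> (deriv \<phi> has_real_derivative deriv (deriv \<phi>) r) (at r)"
  using \<phi>'_diff DERIV_deriv_iff_real_differentiable by blast

lemma \<phi>_cont: "continuous_on {0<..} \<phi>"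
  by (intro continuous_at_imp_continuous_on ballI DERIV_isCont[OF \<phi>_DERIV]) simp

lemma \<phi>'_cont: "continuous_on {0<..} (deriv \<phi>)"
  by (intro continuous_at_imp_continuous_on ballI DERIV_isCont[OF \<phi>'_DERIV]) simp

lemma Icc_sub: "0 < a \<Longrightarrow> {a..e} \<subseteq> {0<..}" for a e :: real by auto

lemma weight_prefactor_primitive:
  assumes "0 < a"
  shows "primitive_on a e (\<lambda>r. \<sigma> * exp (- \<phi> r) / deriv \<phi> r)
    (\<lambda>r. - \<sigma> * exp (- \<phi> r) * (1 + curvature_ratio \<phi> r))"
proof (rule primitive_on_C1)
  fix r assume "r \<in> {a..e}"
  then have r: "0 < r" using assms by auto
  have "((\<lambda>r. \<sigma> * exp (- \<phi> r)) has_real_derivative \<sigma> * (exp (- \<phi> r) * - deriv \<phi> r)) (at r)"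
    by (intro DERIV_cmult DERIV_chain2[OF DERIV_exp] DERIV_minus \<phi>_DERIV r)
  from DERIV_divide[OF this \<phi>'_DERIV[OF r] \<phi>'_nonzero[OF r]]
  show "((\<lambda>r. \<sigma> * exp (- \<phi> r) / deriv \<phi> r) has_real_derivative
      - \<sigma> * exp (- \<phi> r) * (1 + curvature_ratio \<phi> r)) (at r)"
    by (rule DERIV_cong)
       (use \<phi>'_nonzero[OF r] in \<open>simp add: curvature_ratio_def field_simps power2_eq_square\<close>)
next
  note sub = continuous_on_subset[OF _ Icc_sub[OF assms]]
  show "continuous_on {a..e} (\<lambda>r. - \<sigma> * exp (- \<phi> r) * (1 + curvature_ratio \<phi> r))"
    unfolding curvature_ratio_def
    by (intro continuous_intros sub[OF \<phi>_cont] sub[OF \<phi>'_cont] sub[OF \<phi>''_cont] ballI)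
       (use \<phi>'_nonzero assms in auto)
qed

lemma z_primitive:
  assumes "primitive_on a e u v" "0 < a"
  shows "primitive_on a e (z u) (\<lambda>r. deriv \<phi> r * v r + u r * deriv (deriv \<phi>) r)"
  unfolding z_def[abs_def]
  by (intro primitive_on_mult primitive_on_C1 \<phi>'_DERIV assms
      continuous_on_subset[OF \<phi>''_cont Icc_sub]) (use assms in auto)

text \<open>The derivative of the prefactor is \<open>- \<sigma> e\<^bsup>-\<phi>\<^esup> (1 + \<kappa>)\<close> with \<open>\<kappa> = curvature_ratio \<phi>\<close>, and the part
  of the derivative of \<open>z u\<close> that contains \<open>u\<close> is \<open>\<phi>'' u = \<kappa> \<phi>' z u\<close>. Hence the terms without \<open>v\<close>
  combine to a multiple of \<open>\<Phi>(z) - \<kappa> (z \<Phi>'(z) - \<Phi>(z))\<close>.\<close>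

lemma flux_primitive:
  assumes u: "primitive_on a e u v" and a: "0 < a"
  shows "primitive_on a e (flux u) (\<lambda>r. exp (- \<phi> r) * (\<sigma> * \<Phi>' (z u r) * v r
    - \<sigma> * (\<Phi> (z u r) - curvature_ratio \<phi> r * (\<Phi>' (z u r) * z u r - \<Phi> (z u r)))))"
proof (rule primitive_on_cong)
  show "primitive_on a e (\<lambda>r. \<sigma> * exp (- \<phi> r) / deriv \<phi> r * \<Phi> (z u r))
    (\<lambda>r. \<sigma> * exp (- \<phi> r) / deriv \<phi> r * (\<Phi>' (z u r) * (deriv \<phi> r * v r + u r * deriv (deriv \<phi>) r))
      + \<Phi> (z u r) * (- \<sigma> * exp (- \<phi> r) * (1 + curvature_ratio \<phi> r)))"
    by (intro primitive_on_mult weight_prefactor_primitive a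
        primitive_on_compose[OF z_primitive[OF u a] \<Phi>_DERIV \<Phi>'_continuous])
  fix r assume "r \<in> {a..e}"
  then have r: "0 < r" using a by auto
  define w w' where "w = deriv \<phi> r" and "w' = deriv (deriv \<phi>) r"
  have w: "w \<noteq> 0" using \<phi>'_nonzero[OF r] by (simp add: w_def)
  have "\<sigma> * E / w * (P * (w * v r + u r * w')) + Q * (- \<sigma> * E * (1 + w' / w\<^sup>2))
     = E * (\<sigma> * P * v r - \<sigma> * (Q - w' / w\<^sup>2 * (P * (w * u r) - Q)))" for E P Q
    using w by (simp add: field_simps power2_eq_square)
  then show "\<sigma> * exp (- \<phi> r) / deriv \<phi> r * (\<Phi>' (z u r) * (deriv \<phi> r * v r + u r * deriv (deriv \<phi>) r))
      + \<Phi> (z u r) * (- \<sigma> * exp (- \<phi> r) * (1 + curvature_ratio \<phi> r))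
    = exp (- \<phi> r) * (\<sigma> * \<Phi>' (z u r) * v r
    - \<sigma> * (\<Phi> (z u r) - curvature_ratio \<phi> r * (\<Phi>' (z u r) * z u r - \<Phi> (z u r))))"
    unfolding curvature_ratio_def w_def w'_def z_def by blast
qed (simp add: flux_def)

context
  fixes u v :: "real \<Rightarrow> real"
  assumes uv: "primitive_on_half_line u v"
begin

lemma uv_on: "0 < a \<Longrightarrow> primitive_on a e u v"
  using uv unfolding primitive_on_half_line_def
  by (cases "a \<le> e") (auto simp: primitive_on_def)

lemma v_integrable: "0 < a \<Longrightarrow> v absolutely_integrable_on {a..e}"
  using uv_on by (simp add: primitive_on_def)

lemma z_cont: "0 < a \<Longrightarrow> continuous_on {a..e} (z u)"
  by (rule primitive_on_continuous[OF z_primitive[OF uv_on]])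

lemma energy_z_integrable: "0 < a \<Longrightarrow> energy (z u) absolutely_integrable_on {a..e}"
  unfolding energy_def[abs_def]
  by (intro absolutely_integrable_continuous_real continuous_intros
      continuous_on_subset[OF \<phi>_cont Icc_sub] continuous_on_compose2[OF \<Phi>_continuous z_cont]) auto

lemma production_integrable: "0 < a \<Longrightarrow> production u v absolutely_integrable_on {a..e}"
  unfolding production_def[abs_def]
  by (intro absolutely_integrable_continuous_times set_integrable_abs v_integrable continuous_intros
      continuous_on_subset[OF \<phi>_cont Icc_sub] continuous_on_compose2[OF \<Phi>'_continuous z_cont]) auto

lemma flux_increment:
  assumes ac: "0 < a" "a \<le> e"
  shows "flux u e - flux u a \<le> integral {a..e} (production u v) - b * integral {a..e} (energy (z u))"
proof -
  note E = set_lebesgue_integral_eq_integral(1)[OF energy_z_integrable[OF ac(1)]]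
  note P = set_lebesgue_integral_eq_integral(1)[OF production_integrable[OF ac(1)]]
  have up: "((\<lambda>r. production u v r - b * energy (z u) r) has_integral
      integral {a..e} (production u v) - b * integral {a..e} (energy (z u))) {a..e}"
    by (intro has_integral_diff has_integral_mult_right integrable_integral E P)
  show ?thesis
  proof (rule has_integral_le[OF _ up])
    show "((\<lambda>r. exp (- \<phi> r) * (\<sigma> * \<Phi>' (z u r) * v r
        - \<sigma> * (\<Phi> (z u r) - curvature_ratio \<phi> r * (\<Phi>' (z u r) * z u r - \<Phi> (z u r)))))
      has_integral flux u e - flux u a) {a..e}"
      by (rule primitive_onD(1)[OF flux_primitive[OF uv_on[OF ac(1)] ac(1)] order.refl ac(2) order.refl])
    fix r assume "r \<in> {a..e}"
    then have r: "0 < r" using ac by auto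
    have "\<sigma> * (\<Phi>' (z u r) * v r) \<le> \<bar>\<Phi>' (z u r)\<bar> * \<bar>v r\<bar>"
      using \<sigma> abs_ge_self[of "\<Phi>' (z u r) * v r"] abs_ge_minus_self[of "\<Phi>' (z u r) * v r"]
      by (auto simp: abs_mult)
    then have "\<sigma> * \<Phi>' (z u r) * v r
        - \<sigma> * (\<Phi> (z u r) - curvature_ratio \<phi> r * (\<Phi>' (z u r) * z u r - \<Phi> (z u r)))
      \<le> \<bar>\<Phi>' (z u r)\<bar> * \<bar>v r\<bar> - b * \<Phi> (z u r)"
      using coercive[OF r, of "z u r"] by (simp add: mult.assoc)
    from mult_left_mono[OF this, of "exp (- \<phi> r)"]
    show "exp (- \<phi> r) * (\<sigma> * \<Phi>' (z u r) * v r
        - \<sigma> * (\<Phi> (z u r) - curvature_ratio \<phi> r * (\<Phi>' (z u r) * z u r - \<Phi> (z u r))))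
      \<le> production u v r - b * energy (z u) r"
      by (simp add: production_def energy_def algebra_simps)
  qed
qed

lemma flux_increment_le_production:
  assumes ac: "0 < a" "a \<le> e"
  shows "flux u e - flux u a \<le> integral {a..e} (production u v)"
proof -
  have "0 \<le> integral {a..e} (energy (z u))"
    using set_lebesgue_integral_eq_integral(1)[OF energy_z_integrable[OF ac(1)]]
    by (intro integral_nonneg) auto
  then have "0 \<le> b * integral {a..e} (energy (z u))" using b_pos by simp
  then show ?thesis using flux_increment[OF ac]
    by linarith
qed

lemma production_young:
  assumes "0 < \<epsilon>"
  shows "production u v r \<le> \<epsilon> * energy (\<lambda>r. v r / \<epsilon>) r + \<epsilon> * (D - 1) * energy (z u) r"
proof -
  have "\<bar>\<Phi>' (z u r)\<bar> * \<bar>v r\<bar> = \<epsilon> * (\<bar>\<Phi>' (z u r)\<bar> * \<bar>v r / \<epsilon>\<bar>)" using assms by simp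
  also have "\<dots> \<le> \<epsilon> * (\<Phi> (v r / \<epsilon>) + (D - 1) * \<Phi> (z u r))"
    by (intro mult_left_mono young) (use assms in auto)
  finally have "exp (- \<phi> r) * (\<bar>\<Phi>' (z u r)\<bar> * \<bar>v r\<bar>)
      \<le> exp (- \<phi> r) * (\<epsilon> * (\<Phi> (v r / \<epsilon>) + (D - 1) * \<Phi> (z u r)))"
    by (rule mult_left_mono) simp
  then show ?thesis by (simp add: production_def energy_def algebra_simps)
qed

text \<open>In \<open>production_young\<close> the choice \<open>\<epsilon> = b / D\<close> leaves the fraction \<open>1 / D\<close> of the coercive term
  \<open>b \<integral> \<Phi>(z) e\<^bsup>-\<phi>\<^esup>\<close> after absorption. The absorption is legitimate because the integral over a
  compact interval is finite.\<close>

lemma energy_bound_Icc: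
  assumes v: "energy (\<lambda>r. D / b * v r) absolutely_integrable_on {0<..}" and ac: "0 < a" "a \<le> e"
  shows "integral {a..e} (energy (z u)) \<le>
    integral {a..e} (energy (\<lambda>r. D / b * v r)) - D / b * (flux u e - flux u a)"
proof -
  define I J where "I = integral {a..e} (energy (z u))" and "J = integral {a..e} (energy (\<lambda>r. D / b * v r))"
  have \<epsilon>: "0 < b / D" using b_pos D_ge_1 by simp
  note E = set_lebesgue_integral_eq_integral(1)[OF energy_z_integrable[OF ac(1)]]
  note P = set_lebesgue_integral_eq_integral(1)[OF production_integrable[OF ac(1)]]
  note V = set_lebesgue_integral_eq_integral(1)[OF half_line_integral_Icc(1)[OF v energy_nonneg ac(1)]]
  have up: "((\<lambda>r. b / D * energy (\<lambda>r. D / b * v r) r + b / D * (D - 1) * energy (z u) r) has_integral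
      b / D * J + b / D * (D - 1) * I) {a..e}"
    unfolding I_def J_def by (intro has_integral_add has_integral_mult_right integrable_integral E V)
  have "integral {a..e} (production u v) \<le> b / D * J + b / D * (D - 1) * I"
    by (rule has_integral_le[OF integrable_integral[OF P] up]) (use production_young[OF \<epsilon>] in \<open>simp add: mult.commute\<close>)
  with flux_increment[OF ac] have "b * I \<le> b / D * J + b / D * (D - 1) * I - (flux u e - flux u a)"
    by (simp add: I_def)
  from mult_left_mono[OF this, of "D / b"]
  have "D / b * (b * I) \<le> D / b * (b / D * J + b / D * (D - 1) * I - (flux u e - flux u a))"
    using b_pos D_ge_1 by simp
  moreover have "D / b * (b / D * J + b / D * (D - 1) * I - X) = J + (D - 1) * I - D / b * X" for X
    using b_pos D_ge_1 by (simp add: field_simps)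
  ultimately have "D * I \<le> J + (D - 1) * I - D / b * (flux u e - flux u a)"
    using b_pos by simp
  then show ?thesis unfolding I_def J_def by (simp add: left_diff_distrib)
qed

end

end

section \<open>Decay of the flux at infinity\<close>

context hardy_flux begin

text \<open>The one-sided form of the boundary condition: the lower limit of the increments of the flux
  along the two sequences is nonnegative.\<close>

definition admissible :: "(real \<Rightarrow> real) \<Rightarrow> (nat \<Rightarrow> real) \<Rightarrow> (nat \<Rightarrow> real) \<Rightarrow> bool" where
  "admissible u s R \<longleftrightarrow> (\<forall>n. 0 < s n) \<and> s \<longlonglongrightarrow> 0 \<and> filterlim R at_top sequentially \<and>
     (\<forall>\<eta>>0. \<forall>\<^sub>F n in sequentially. flux u (s n) - \<eta> \<le> flux u (R n))"

text \<open>The intervals \<open>{s n..R n}\<close> eventually contain any given compact interval, and the flux term in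
  \<open>energy_bound_Icc\<close> contributes at most an arbitrarily small amount.\<close>

lemma energy_hardy:
  assumes uv: "primitive_on_half_line u v" and adm: "admissible u s R"
    and v: "energy (\<lambda>r. D / b * v r) absolutely_integrable_on {0<..}"
  shows "energy (z u) absolutely_integrable_on {0<..}"
    and "integral {0<..} (energy (z u)) \<le> integral {0<..} (energy (\<lambda>r. D / b * v r))"
proof -
  let ?J = "integral {0<..} (energy (\<lambda>r. D / b * v r))"
  have bound: "integral {a..e} (energy (z u)) \<le> ?J" if ae: "0 < a" "a \<le> e" for a e
  proof (rule field_le_epsilon)
    fix \<eta> :: real assume \<eta>: "0 < \<eta>"
    have \<eta>': "0 < b / D * \<eta>" using \<eta> b_pos D_ge_1 by simp
    have "\<forall>\<^sub>F n in sequentially. s n < a \<and> e \<le> R n \<and> flux u (s n) - b / D * \<eta> \<le> flux u (R n)"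
      using adm \<eta>' ae(1) unfolding admissible_def filterlim_at_top
      by (intro eventually_conj) (auto dest: order_tendstoD(2))
    then obtain n where n: "s n < a" "e \<le> R n" "flux u (s n) - b / D * \<eta> \<le> flux u (R n)"
      using eventually_happens'[OF sequentially_bot] by blast
    have s: "0 < s n" "s n \<le> R n" using adm n ae by (auto simp: admissible_def)
    have "integral {a..e} (energy (z u)) \<le> integral {s n..R n} (energy (z u))"
      by (rule integral_subset_le)
         (use n s ae in \<open>auto intro!: set_lebesgue_integral_eq_integral(1) energy_z_integrable[OF uv]\<close>)
    also have "\<dots> \<le> integral {s n..R n} (energy (\<lambda>r. D / b * v r)) - D / b * (flux u (R n) - flux u (s n))"
      by (rule energy_bound_Icc[OF uv v s])
    also have "integral {s n..R n} (energy (\<lambda>r. D / b * v r)) \<le> ?J"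
      by (rule half_line_integral_Icc(2)[OF v energy_nonneg s(1)])
    also have "?J - D / b * (flux u (R n) - flux u (s n)) \<le> ?J + \<eta>"
    proof -
      have "D / b * (flux u (s n) - flux u (R n)) \<le> D / b * (b / D * \<eta>)"
        using n(3) b_pos D_ge_1 by (intro mult_left_mono) auto
      also have "\<dots> = \<eta>" using b_pos D_ge_1 by simp
      finally show ?thesis by (simp add: right_diff_distrib)
    qed
    finally show "integral {a..e} (energy (z u)) \<le> ?J + \<eta>" by simp
  qed
  show "energy (z u) absolutely_integrable_on {0<..}" "integral {0<..} (energy (z u)) \<le> ?J"
    using half_line_integrable_if_bounded[OF energy_nonneg energy_z_integrable[OF uv] bound] by auto
qed

lemma production_integrable_half_line:
  assumes uv: "primitive_on_half_line u v"
    and v: "energy v absolutely_integrable_on {0<..}"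
    and zu: "energy (z u) absolutely_integrable_on {0<..}"
  shows "production u v absolutely_integrable_on {0<..}"
proof (rule half_line_integrable_if_bounded(1)[OF production_nonneg production_integrable[OF uv]])
  fix a e :: real assume ae: "0 < a" "a \<le> e"
  note V = half_line_integral_Icc[OF v energy_nonneg ae(1)]
  note Z = half_line_integral_Icc[OF zu energy_nonneg ae(1)]
  note P = set_lebesgue_integral_eq_integral(1)[OF production_integrable[OF uv ae(1)]]
  have up: "((\<lambda>r. energy v r + (D - 1) * energy (z u) r) has_integral
      integral {a..e} (energy v) + (D - 1) * integral {a..e} (energy (z u))) {a..e}"
    by (intro has_integral_add has_integral_mult_right integrable_integral
        set_lebesgue_integral_eq_integral(1) V Z)
  have "integral {a..e} (production u v) \<le> integral {a..e} (energy v) + (D - 1) * integral {a..e} (energy (z u))"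
    by (rule has_integral_le[OF integrable_integral[OF P] up])
       (use production_young[OF uv, of 1] in simp)
  also have "\<dots> \<le> integral {0<..} (energy v) + (D - 1) * integral {0<..} (energy (z u))"
    using D_ge_1 by (intro add_mono mult_left_mono V Z) auto
  finally show "integral {a..e} (production u v)
    \<le> integral {0<..} (energy v) + (D - 1) * integral {0<..} (energy (z u))" .
qed auto

lemma abs_flux: "0 < r \<Longrightarrow> \<bar>flux u r\<bar> * \<bar>deriv \<phi> r\<bar> = energy (z u) r"
  using \<sigma> \<phi>'_nonzero[of r] by (auto simp: flux_def energy_def abs_mult)

text \<open>Since \<open>d \<ge> 1\<close>, \<open>\<Phi>(z) \<le> \<bar>\<Phi>'(z)\<bar> \<bar>z\<bar>\<close>; divide by \<open>\<bar>\<phi>'\<bar>\<close>. If the flux is bounded away from \<open>0\<close>, this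
  makes the logarithmic derivative \<open>v / u\<close> integrable.\<close>

lemma production_ge_flux: "0 < r \<Longrightarrow> \<bar>flux u r\<bar> * \<bar>v r\<bar> \<le> production u v r * \<bar>u r\<bar>"
proof -
  assume r: "0 < r"
  have w: "0 < \<bar>deriv \<phi> r\<bar>" using \<phi>'_nonzero[OF r] by simp
  have "\<bar>flux u r\<bar> * \<bar>deriv \<phi> r\<bar> \<le> exp (- \<phi> r) * (\<bar>\<Phi>' (z u r)\<bar> * \<bar>z u r\<bar>)"
    using mult_left_mono[OF \<Phi>'_ge[of "z u r"], of "exp (- \<phi> r)"]
    unfolding abs_flux[OF r] energy_def by (simp add: mult.commute)
  also have "\<dots> = exp (- \<phi> r) * \<bar>\<Phi>' (z u r)\<bar> * \<bar>u r\<bar> * \<bar>deriv \<phi> r\<bar>"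
    by (simp add: z_def abs_mult)
  finally have "\<bar>flux u r\<bar> \<le> exp (- \<phi> r) * \<bar>\<Phi>' (z u r)\<bar> * \<bar>u r\<bar>" using w by simp
  from mult_right_mono[OF this, of "\<bar>v r\<bar>"] show ?thesis
    by (simp add: production_def algebra_simps)
qed

text \<open>Beyond a point \<open>N\<close> the tail integral of \<open>\<bar>v\<bar> / \<bar>u\<bar>\<close> is at most \<open>1 / 2\<close>. At a point \<open>x\<close> where \<open>\<bar>u\<bar>\<close>
  is maximal on \<open>{N..r}\<close> this gives \<open>\<bar>u x - u N\<bar> \<le> \<bar>u x\<bar> / 2\<close>, so \<open>\<bar>u x\<bar> \<le> 2 \<bar>u N\<bar>\<close>.\<close>

lemma u_bounded_if_flux_bounded_below:
  assumes uv: "primitive_on_half_line u v"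
    and P: "production u v absolutely_integrable_on {0<..}"
    and \<gamma>: "0 < \<gamma>" and fl: "\<And>r. r0 < r \<Longrightarrow> \<gamma> \<le> \<bar>flux u r\<bar>"
  obtains N B where "1 \<le> N" "r0 < N" "0 < B" "\<And>r. N \<le> r \<Longrightarrow> \<bar>u r\<bar> \<le> B"
proof -
  obtain N0 where N0: "1 \<le> N0" "\<And>a e. N0 \<le> a \<Longrightarrow> a \<le> e \<Longrightarrow> integral {a..e} (production u v) \<le> \<gamma> / 2"
    using small_tail[OF P production_nonneg, of "\<gamma> / 2"] \<gamma> by auto
  define N where "N = max N0 (r0 + 1)"
  have N: "N0 \<le> N" "1 \<le> N" "r0 < N" using N0 by (auto simp: N_def)
  have bound: "\<bar>u r\<bar> \<le> 2 * \<bar>u N\<bar>" if r: "N \<le> r" for r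
  proof -
    have "continuous_on {N..r} (\<lambda>x. \<bar>u x\<bar>)"
      using primitive_on_continuous[OF uv_on[OF uv]] N by (intro continuous_intros) auto
    then obtain x where x: "x \<in> {N..r}" and max: "\<And>y. y \<in> {N..r} \<Longrightarrow> \<bar>u y\<bar> \<le> \<bar>u x\<bar>"
      using continuous_attains_sup[of "{N..r}" "\<lambda>x. \<bar>u x\<bar>"] r by auto
    have Nx: "0 < N" "N \<le> x" using N x by auto
    have pv: "(v has_integral u x - u N) {N..x}"
      using primitive_onD(1)[OF uv_on[OF uv Nx(1)] order.refl Nx(2) order.refl] .
    have ip: "production u v integrable_on {N..x}"
      by (rule set_lebesgue_integral_eq_integral(1)[OF production_integrable[OF uv Nx(1)]])
    have "norm (integral {N..x} v) \<le> integral {N..x} (\<lambda>y. \<bar>u x\<bar> / \<gamma> * production u v y)"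
    proof (rule integral_norm_bound_integral)
      show "v integrable_on {N..x}" using pv by blast
      show "(\<lambda>y. \<bar>u x\<bar> / \<gamma> * production u v y) integrable_on {N..x}"
        by (rule integrable_on_mult_right[OF ip])
      fix y assume y: "y \<in> {N..x}"
      have "\<gamma> * \<bar>v y\<bar> \<le> \<bar>flux u y\<bar> * \<bar>v y\<bar>" using fl[of y] y N by (intro mult_right_mono) auto
      also have "\<dots> \<le> production u v y * \<bar>u y\<bar>" using production_ge_flux[of y] y N by auto
      also have "\<dots> \<le> production u v y * \<bar>u x\<bar>" using max[of y] y x by (intro mult_left_mono) auto
      finally show "norm (v y) \<le> \<bar>u x\<bar> / \<gamma> * production u v y" using \<gamma> by (simp add: field_simps)
    qed
    also have "\<dots> = \<bar>u x\<bar> / \<gamma> * integral {N..x} (production u v)" by simp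
    also have "\<dots> \<le> \<bar>u x\<bar> / \<gamma> * (\<gamma> / 2)"
      using N0(2)[of N x] N Nx \<gamma> by (intro mult_left_mono) auto
    finally have "\<bar>u x - u N\<bar> \<le> \<bar>u x\<bar> / 2" using \<gamma> integral_unique[OF pv] by simp
    then show ?thesis using max[of r] r abs_triangle_ineq2[of "u x" "u N"] by auto
  qed
  show thesis
  proof (rule that[OF N(2,3), of "2 * \<bar>u N\<bar> + 1"])
    show "\<bar>u r\<bar> \<le> 2 * \<bar>u N\<bar> + 1" if "N \<le> r" for r using bound[OF that] by simp
  qed simp
qed

lemma \<phi>_increment:
  assumes "0 < N" "N \<le> r"
  shows "(deriv \<phi> has_integral \<phi> r - \<phi> N) {N..r}" "(\<lambda>x. \<bar>deriv \<phi> x\<bar>) integrable_on {N..r}"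
proof -
  have c: "continuous_on {N..r} (deriv \<phi>)" by (rule continuous_on_subset[OF \<phi>'_cont Icc_sub[OF assms(1)]])
  have "primitive_on N r \<phi> (deriv \<phi>)"
    using assms c by (intro primitive_on_C1 \<phi>_DERIV) auto
  from primitive_onD(1)[OF this order.refl assms(2) order.refl]
  show "(deriv \<phi> has_integral \<phi> r - \<phi> N) {N..r}" .
  show "(\<lambda>x. \<bar>deriv \<phi> x\<bar>) integrable_on {N..r}"
    by (intro integrable_continuous_interval continuous_intros c)
qed

text \<open>Otherwise \<open>u\<close> is bounded near infinity by the previous argument, and \<open>\<gamma> \<bar>\<phi>'\<bar>\<close> is at most the
  energy density of \<open>z u\<close>, hence integrable. So \<open>\<phi>\<close> is bounded below near infinity and \<open>\<bar>\<phi>'\<bar>\<close> takes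
  arbitrarily small values there. Since \<open>\<Phi>\<close> is sublinear at \<open>0\<close>, \<open>\<bar>flux\<bar> = \<Phi>(\<phi>' u) e\<^bsup>-\<phi>\<^esup> / \<bar>\<phi>'\<bar>\<close> is
  small at such points.\<close>

lemma flux_small_somewhere:
  assumes uv: "primitive_on_half_line u v"
    and P: "production u v absolutely_integrable_on {0<..}"
    and Z: "energy (z u) absolutely_integrable_on {0<..}" and \<gamma>: "0 < \<gamma>"
  shows "\<exists>r>r0. \<bar>flux u r\<bar> < \<gamma>"
proof (rule ccontr)
  assume "\<not> ?thesis"
  then have fl: "\<And>r. r0 < r \<Longrightarrow> \<gamma> \<le> \<bar>flux u r\<bar>" by force
  obtain N B where N: "1 \<le> N" "r0 < N" and B: "0 < B" "\<And>r. N \<le> r \<Longrightarrow> \<bar>u r\<bar> \<le> B"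
    using u_bounded_if_flux_bounded_below[OF uv P \<gamma> fl] by blast
  define K where "K = integral {0<..} (energy (z u)) / \<gamma>"
  have \<phi>': "integral {N..r} (\<lambda>x. \<bar>deriv \<phi> x\<bar>) \<le> K" if r: "N \<le> r" for r
  proof -
    have "integral {N..r} (\<lambda>x. \<bar>deriv \<phi> x\<bar>) \<le> integral {N..r} (\<lambda>x. energy (z u) x / \<gamma>)"
    proof (rule integral_le)
      show "(\<lambda>x. \<bar>deriv \<phi> x\<bar>) integrable_on {N..r}" using \<phi>_increment(2)[OF _ r] N by simp
      show "(\<lambda>x. energy (z u) x / \<gamma>) integrable_on {N..r}"
        using set_lebesgue_integral_eq_integral(1)[OF energy_z_integrable[OF uv]] N
        by (intro integrable_on_divide) auto
      fix x assume x: "x \<in> {N..r}"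
      have "\<gamma> * \<bar>deriv \<phi> x\<bar> \<le> energy (z u) x"
        using mult_right_mono[OF fl[of x], of "\<bar>deriv \<phi> x\<bar>"] abs_flux[of x u] x N by simp
      then show "\<bar>deriv \<phi> x\<bar> \<le> energy (z u) x / \<gamma>" using \<gamma> by (simp add: field_simps)
    qed
    also have "\<dots> \<le> K"
      using half_line_integral_Icc(2)[OF Z energy_nonneg, of N r] N \<gamma>
      by (simp add: K_def divide_right_mono)
    finally show ?thesis .
  qed
  have \<phi>_ge: "\<phi> N - K \<le> \<phi> r" if r: "N \<le> r" for r
  proof -
    have "norm (integral {N..r} (deriv \<phi>)) \<le> integral {N..r} (\<lambda>x. \<bar>deriv \<phi> x\<bar>)"
      using \<phi>_increment[OF _ r] N by (intro integral_norm_bound_integral) auto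
    then show ?thesis using \<phi>'[OF r] integral_unique[OF \<phi>_increment(1)[OF _ r]] N by auto
  qed
  \<comment> \<open>\<open>\<epsilon>\<close> is chosen such that \<open>\<Phi>(w B) \<le> \<epsilon> w B\<close> undercuts the lower bound \<open>\<gamma> w e0\<close> by the factor two.\<close>
  define e0 where "e0 = exp (\<phi> N - K)"
  define \<epsilon> where "\<epsilon> = \<gamma> * e0 / (2 * B)"
  have \<epsilon>: "0 < \<epsilon>" using \<gamma> B by (simp add: \<epsilon>_def e0_def)
  obtain \<delta> where \<delta>: "0 < \<delta>" "\<And>t. \<bar>t\<bar> < \<delta> \<Longrightarrow> \<Phi> t \<le> \<epsilon> * \<bar>t\<bar>"
    using \<Phi>_sublinear_at_0[OF \<epsilon>] by blast
  have "\<exists>r\<ge>N. \<bar>deriv \<phi> r\<bar> < \<delta> / B"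
  proof (rule ccontr)
    assume "\<not> ?thesis"
    then have ge: "\<And>r. N \<le> r \<Longrightarrow> \<delta> / B \<le> \<bar>deriv \<phi> r\<bar>" by force
    \<comment> \<open>An interval so long that \<open>\<bar>\<phi>'\<bar> \<ge> \<delta> / B\<close> on it would force the integral of \<open>\<bar>\<phi>'\<bar>\<close> above \<open>K\<close>.\<close>
    define r where "r = N + (\<bar>K\<bar> + 1) * B / \<delta>"
    have r: "N \<le> r" using B \<delta> by (simp add: r_def)
    have "integral {N..r} (\<lambda>x. \<delta> / B) \<le> integral {N..r} (\<lambda>x. \<bar>deriv \<phi> x\<bar>)"
      using \<phi>_increment(2)[OF _ r] N ge by (intro integral_le) auto
    moreover have "integral {N..r} (\<lambda>x. \<delta> / B) = \<bar>K\<bar> + 1"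
      using r B \<delta> by (simp add: r_def)
    ultimately show False using \<phi>'[OF r] by linarith
  qed
  then obtain r where r: "N \<le> r" "\<bar>deriv \<phi> r\<bar> < \<delta> / B" by blast
  have r0: "0 < r" "r0 < r" using r N by auto
  define w where "w = \<bar>deriv \<phi> r\<bar>"
  have w: "0 < w" "w * B < \<delta>" using \<phi>'_nonzero[OF r0(1)] r B by (auto simp: w_def field_simps)
  have "\<gamma> * w \<le> \<Phi> (z u r) * exp (- \<phi> r)"
    using mult_right_mono[OF fl[OF r0(2)], of w] abs_flux[OF r0(1), of u] by (simp add: w_def energy_def)
  then have "\<gamma> * w * exp (\<phi> r) \<le> \<Phi> (z u r)" by (simp add: exp_minus field_simps)
  moreover have "\<gamma> * w * e0 \<le> \<gamma> * w * exp (\<phi> r)"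
    using \<phi>_ge[OF r(1)] \<gamma> w by (intro mult_left_mono) (auto simp: e0_def)
  moreover have "\<Phi> (z u r) \<le> \<Phi> (w * B)"
    using B(2)[OF r(1)] w by (intro \<Phi>_mono) (auto simp: z_def w_def abs_mult mult_left_mono)
  moreover have "\<Phi> (w * B) \<le> \<epsilon> * (w * B)" using \<delta>(2)[of "w * B"] w B by simp
  moreover have "\<epsilon> * (w * B) = \<gamma> * w * e0 / 2" using B by (simp add: \<epsilon>_def)
  ultimately have "\<gamma> * w * e0 \<le> 0" by simp
  moreover have "0 < \<gamma> * w * e0" using \<gamma> w by (simp add: e0_def)
  ultimately show False by simp
qed

lemma flux_sign:
  shows "(\<forall>u. \<forall>r>0. 0 \<le> flux u r) \<or> (\<forall>u. \<forall>r>0. flux u r \<le> 0)"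
proof -
  have "connected ({0<..} :: real set)" by (rule convex_connected) simp
  then have conn: "connected (deriv \<phi> ` {0<..})"
    by (rule connected_continuous_image[OF \<phi>'_cont])
  have "(\<forall>r>0. 0 < deriv \<phi> r) \<or> (\<forall>r>0. deriv \<phi> r < 0)"
  proof (rule ccontr)
    assume "\<not> ?thesis"
    then obtain r1 r2 where r: "0 < r1" "0 < r2" "deriv \<phi> r1 \<le> 0" "0 \<le> deriv \<phi> r2"
      by (metis linorder_not_less)
    then have "0 \<in> deriv \<phi> ` {0<..}"
      using connectedD_interval[OF conn, of "deriv \<phi> r1" "deriv \<phi> r2" 0] by auto
    then show False using \<phi>'_nonzero by auto
  qed
  with \<sigma> have "(\<forall>r>0. 0 \<le> \<sigma> / deriv \<phi> r) \<or> (\<forall>r>0. \<sigma> / deriv \<phi> r \<le> 0)"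
    by (elim disjE) (simp_all add: less_imp_le)
  moreover have "flux u r = \<sigma> / deriv \<phi> r * energy (z u) r" for u r
    by (simp add: flux_def energy_def)
  ultimately show ?thesis
    by (metis energy_nonneg mult_nonneg_nonneg mult_nonpos_nonneg)
qed

text \<open>The flux is almost decreasing near infinity, since its increments are at most a tail of the
  integral of the production. So it stays between its small values before and after a given
  point.\<close>

lemma flux_tendsto_0:
  assumes uv: "primitive_on_half_line u v"
    and P: "production u v absolutely_integrable_on {0<..}"
    and Z: "energy (z u) absolutely_integrable_on {0<..}"
  shows "(flux u \<longlongrightarrow> 0) at_top"
proof (rule tendstoI)
  fix \<gamma> :: real assume \<gamma>: "0 < \<gamma>"
  obtain N where N: "1 \<le> N" "\<And>a e. N \<le> a \<Longrightarrow> a \<le> e \<Longrightarrow> integral {a..e} (production u v) \<le> \<gamma> / 2"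
    using small_tail[OF P production_nonneg, of "\<gamma> / 2"] \<gamma> by auto
  have inc: "flux u e \<le> flux u a + \<gamma> / 2" if "N \<le> a" "a \<le> e" for a e
    using flux_increment_le_production[OF uv, of a e] N(2)[OF that] N(1) that by simp
  have small: "\<exists>r>r0. \<bar>flux u r\<bar> < \<gamma> / 2" for r0
    by (rule flux_small_somewhere[OF uv P Z]) (use \<gamma> in simp)
  obtain r1 where r1: "N < r1" "\<bar>flux u r1\<bar> < \<gamma> / 2" using small by blast
  have "\<bar>flux u r\<bar> < \<gamma>" if r: "r1 \<le> r" for r
  proof -
    obtain r2 where r2: "r < r2" "\<bar>flux u r2\<bar> < \<gamma> / 2" using small by blast
    have "flux u r \<le> flux u r1 + \<gamma> / 2" "flux u r2 \<le> flux u r + \<gamma> / 2"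
      using inc r1 r r2 by auto
    then show ?thesis using r1 r2 by linarith
  qed
  then show "\<forall>\<^sub>F r in at_top. dist (flux u r) 0 < \<gamma>"
    unfolding eventually_at_top_linorder by (auto simp: dist_real_def)
qed

lemma flux_scale:
  assumes "0 < k"
  shows "\<bar>flux (\<lambda>r. k * u r) r\<bar> \<le> c d D k * \<bar>flux u r\<bar>"
proof -
  have "z (\<lambda>r. k * u r) r = k * z u r" by (simp add: z_def)
  then have "\<bar>flux (\<lambda>r. k * u r) r\<bar> = \<bar>\<sigma> * exp (- \<phi> r) / deriv \<phi> r\<bar> * \<Phi> (k * z u r)"
    by (simp add: flux_def abs_mult)
  also have "\<dots> \<le> \<bar>\<sigma> * exp (- \<phi> r) / deriv \<phi> r\<bar> * (c d D k * \<Phi> (z u r))"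
    by (intro mult_left_mono \<Phi>_scale assms) simp
  finally show ?thesis by (simp add: flux_def abs_mult mult.left_commute)
qed

text \<open>If the flux is nonnegative, then \<open>flux u (R n)\<close> tending to \<open>0\<close> and admissibility make
  \<open>flux u (s n)\<close> small, hence also the flux of \<open>k u\<close> at \<open>s n\<close>, while its value at \<open>R n\<close> is
  nonnegative. If the flux is nonpositive, only the values at \<open>R n\<close> matter, and these are small.\<close>

lemma admissible_scale:
  assumes uv: "primitive_on_half_line u v" and adm: "admissible u s R"
    and P: "production u v absolutely_integrable_on {0<..}"
    and Z: "energy (z u) absolutely_integrable_on {0<..}" and k: "0 < k"
  shows "admissible (\<lambda>r. k * u r) s R"
proof -
  let ?uk = "\<lambda>r. k * u r"
  have R: "filterlim R at_top sequentially" using adm by (simp add: admissible_def)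
  have s: "0 < s n" for n using adm by (simp add: admissible_def)
  have "\<forall>\<^sub>F n in sequentially. flux ?uk (s n) - \<eta> \<le> flux ?uk (R n)" if \<eta>: "0 < \<eta>" for \<eta>
  proof -
    define \<gamma> where "\<gamma> = \<eta> / (2 * c d D k)"
    have \<gamma>: "0 < \<gamma>" "c d D k * (2 * \<gamma>) = \<eta>" using \<eta> c_pos[OF k] by (auto simp: \<gamma>_def)
    have "((\<lambda>n. flux u (R n)) \<longlongrightarrow> 0) sequentially"
      by (rule filterlim_compose[OF flux_tendsto_0[OF uv P Z] R])
    then have "\<forall>\<^sub>F n in sequentially. \<bar>flux u (R n)\<bar> < \<gamma>"
      using \<gamma>(1) by (auto dest: tendstoD simp: dist_real_def)
    moreover have "\<forall>\<^sub>F n in sequentially. flux u (s n) - \<gamma> \<le> flux u (R n)"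
      using adm \<gamma>(1) by (simp add: admissible_def)
    moreover have "\<forall>\<^sub>F n in sequentially. 0 < R n"
      using R by (simp add: filterlim_at_top_dense)
    ultimately show ?thesis
    proof eventually_elim
      case (elim n)
      have scale: "\<bar>flux ?uk r\<bar> \<le> \<eta>" if "\<bar>flux u r\<bar> \<le> 2 * \<gamma>" for r
        using flux_scale[OF k, of u r] mult_left_mono[OF that, of "c d D k"] c_pos[OF k] \<gamma>(2) by simp
      from flux_sign show ?case
      proof
        assume pos: "\<forall>u. \<forall>r>0. 0 \<le> flux u r"
        then have "\<bar>flux ?uk (s n)\<bar> \<le> \<eta>" using elim s by (intro scale) auto
        moreover have "0 \<le> flux ?uk (R n)" using pos elim by blast
        ultimately show ?thesis by simp
      next
        assume neg: "\<forall>u. \<forall>r>0. flux u r \<le> 0"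
        have "\<bar>flux ?uk (R n)\<bar> \<le> \<eta>" using elim \<gamma>(1) by (intro scale) auto
        moreover have "flux ?uk (s n) \<le> 0" using neg s by blast
        ultimately show ?thesis by simp
      qed
    qed
  qed
  then show ?thesis using adm by (simp add: admissible_def)
qed

end

section \<open>Modular and norm inequality\<close>

context hardy_flux begin

lemma \<phi>_measurable: "\<phi> \<in> borel_measurable (lebesgue_on {0<..})"
  by (rule continuous_imp_measurable_on_sets_lebesgue[OF \<phi>_cont]) simp

lemma energy_measurable:
  assumes "f \<in> borel_measurable (lebesgue_on {0<..})"
  shows "energy f \<in> borel_measurable (lebesgue_on {0<..})"
proof -
  have "\<Phi> \<in> borel_measurable borel"
    by (rule borel_measurable_continuous_onI[OF \<Phi>_continuous])
  from measurable_compose[OF assms this] show ?thesis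
    unfolding energy_def[abs_def] using \<phi>_measurable by measurable
qed

lemma energy_scale:
  assumes f: "energy f absolutely_integrable_on {0<..}"
    and m: "f \<in> borel_measurable (lebesgue_on {0<..})" and k: "0 < k"
  shows "energy (\<lambda>r. k * f r) absolutely_integrable_on {0<..}"
    and "integral {0<..} (energy (\<lambda>r. k * f r)) \<le> c d D k * integral {0<..} (energy f)"
proof -
  have le: "energy (\<lambda>r. k * f r) r \<le> c d D k * energy f r" for r
    using mult_right_mono[OF \<Phi>_scale[OF k, of "f r"], of "exp (- \<phi> r)"]
    by (simp add: energy_def mult.assoc)
  have cf: "(\<lambda>r. c d D k * energy f r) absolutely_integrable_on {0<..}"
    by (rule set_integrable_mult_right[OF f])
  show kf: "energy (\<lambda>r. k * f r) absolutely_integrable_on {0<..}"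
  proof (rule half_line_nn_integral(2)[OF energy_nonneg])
    show "energy (\<lambda>r. k * f r) \<in> borel_measurable (lebesgue_on {0<..})"
      using m by (intro energy_measurable borel_measurable_times) auto
    have "(\<integral>\<^sup>+r. ennreal (energy (\<lambda>r. k * f r) r) \<partial>lebesgue_on {0<..})
        \<le> (\<integral>\<^sup>+r. ennreal (c d D k * energy f r) \<partial>lebesgue_on {0<..})"
      by (intro nn_integral_mono ennreal_leI le)
    also have "\<dots> < \<infinity>"
      using c_pos[OF k] by (subst half_line_nn_integral(1)[OF _ cf]) auto
    finally show "(\<integral>\<^sup>+r. ennreal (energy (\<lambda>r. k * f r) r) \<partial>lebesgue_on {0<..}) < \<infinity>" .
  qed
  have "integral {0<..} (energy (\<lambda>r. k * f r)) \<le> integral {0<..} (\<lambda>r. c d D k * energy f r)"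
    by (intro integral_le set_lebesgue_integral_eq_integral(1)[OF kf]
        set_lebesgue_integral_eq_integral(1)[OF cf] le)
  then show "integral {0<..} (energy (\<lambda>r. k * f r)) \<le> c d D k * integral {0<..} (energy f)" by simp
qed

lemma modular_hardy:
  assumes uv: "primitive_on_half_line u v" and adm: "admissible u s R"
  shows "(\<integral>\<^sup>+r. ennreal (energy (z u) r) \<partial>lebesgue_on {0<..})
    \<le> ennreal (c d D (D / b)) * (\<integral>\<^sup>+r. ennreal (energy v r) \<partial>lebesgue_on {0<..})"
proof (cases "(\<integral>\<^sup>+r. ennreal (energy v r) \<partial>lebesgue_on {0<..}) < \<infinity>")
  case True
  have Db: "0 < D / b" using b_pos D_ge_1 by simp
  have m: "v \<in> borel_measurable (lebesgue_on {0<..})"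
    by (rule locally_integrable_measurable) (rule v_integrable[OF uv])
  have v: "energy v absolutely_integrable_on {0<..}"
    by (rule half_line_nn_integral(2)[OF energy_nonneg energy_measurable[OF m] True])
  note Dv = energy_scale[OF v m Db]
  note Z = energy_hardy[OF uv adm Dv(1)]
  have "integral {0<..} (energy (z u)) \<le> c d D (D / b) * integral {0<..} (energy v)"
    using Z(2) Dv(2) by simp
  then show ?thesis
    using c_pos[OF Db]
    by (simp add: half_line_nn_integral(1) Z(1) v ennreal_leI flip: ennreal_mult')
next
  case False
  have "0 < c d D (D / b)" using b_pos D_ge_1 by (intro c_pos) simp
  moreover have "(\<integral>\<^sup>+r. ennreal (energy v r) \<partial>lebesgue_on {0<..}) = \<infinity>"
    using False by (simp add: less_top[symmetric])
  ultimately show ?thesis by (simp add: ennreal_mult_top)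
qed

lemma nn_integral_weight_measure:
  assumes m: "f \<in> borel_measurable (lebesgue_on {0<..})" and K: "0 < K"
  shows "(\<integral>\<^sup>+r. ennreal (M (\<bar>f r\<bar> / K)) \<partial>weight_measure \<phi>)
    = (\<integral>\<^sup>+r. ennreal (energy (\<lambda>r. 1 / K * f r) r) \<partial>lebesgue_on {0<..})"
proof -
  have eq: "M (\<bar>f r\<bar> / K) = \<Phi> (1 / K * f r)" for r using K by (simp add: \<Phi>_def)
  have "\<Phi> \<in> borel_measurable borel"
    by (rule borel_measurable_continuous_onI[OF \<Phi>_continuous])
  moreover have "(\<lambda>r. 1 / K * f r) \<in> borel_measurable (lebesgue_on {0<..})" using m by measurable
  ultimately have "(\<lambda>r. \<Phi> (1 / K * f r)) \<in> borel_measurable (lebesgue_on {0<..})"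
    by (rule measurable_compose[rotated])
  then show ?thesis
    unfolding weight_measure_def eq energy_def using \<phi>_measurable
    by (subst nn_integral_density) (auto simp: ennreal_mult' mult.commute)
qed

text \<open>If \<open>K\<close> is admitted in the norm of \<open>v\<close>, then the inequality for \<open>k u\<close> with \<open>k = 1 / (K D / b)\<close>
  shows that \<open>K D / b\<close> is admitted in the norm of \<open>z u\<close>. The scaling lemma for the boundary condition
  applies, because the energies of \<open>v\<close> and \<open>z u\<close> are finite by the growth of \<open>\<Phi>\<close>.\<close>

lemma luxemburg_hardy:
  assumes uv: "primitive_on_half_line u v" and adm: "admissible u s R"
    and C: "D / b \<le> C"
  shows "luxemburg_norm M (weight_measure \<phi>) (z u) \<le> ennreal C * luxemburg_norm M (weight_measure \<phi>) v"
proof -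
  let ?S = "\<lambda>f. {ennreal K | K. K > 0 \<and> (\<integral>\<^sup>+r. ennreal (M (\<bar>f r\<bar> / K)) \<partial>weight_measure \<phi>) \<le> 1}"
  have Db: "0 < D / b" using b_pos D_ge_1 by simp
  have mv: "v \<in> borel_measurable (lebesgue_on {0<..})"
    by (rule locally_integrable_measurable) (rule v_integrable[OF uv])
  have mz: "z u \<in> borel_measurable (lebesgue_on {0<..})"
    by (rule locally_integrable_measurable) (intro absolutely_integrable_continuous_real z_cont[OF uv])
  have bound: "luxemburg_norm M (weight_measure \<phi>) (z u) \<le> ennreal C * x" if x: "x \<in> ?S v" for x
  proof -
    obtain K where K: "0 < K" "x = ennreal K"
      and le1: "(\<integral>\<^sup>+r. ennreal (energy (\<lambda>r. 1 / K * v r) r) \<partial>lebesgue_on {0<..}) \<le> 1"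
      using x nn_integral_weight_measure[OF mv] by auto
    have mK: "(\<lambda>r. 1 / K * v r) \<in> borel_measurable (lebesgue_on {0<..})" using mv by measurable
    have vK: "energy (\<lambda>r. 1 / K * v r) absolutely_integrable_on {0<..}"
      by (rule half_line_nn_integral(2)[OF energy_nonneg energy_measurable[OF mK]])
         (use le1 in \<open>auto intro: le_less_trans\<close>)
    have v: "energy v absolutely_integrable_on {0<..}"
      using energy_scale(1)[OF vK mK K(1)] K by simp
    have Z: "energy (z u) absolutely_integrable_on {0<..}"
      by (rule energy_hardy(1)[OF uv adm energy_scale(1)[OF v mv Db]])
    define k where "k = 1 / (D / b * K)"
    have k: "0 < k" "D / b * (k * t) = 1 / K * t" for t
      using K b_pos D_ge_1 by (auto simp: k_def)
    have adm': "admissible (\<lambda>r. k * u r) s R"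
      by (rule admissible_scale[OF uv adm production_integrable_half_line[OF uv v Z] Z k(1)])
    note uv' = primitive_on_half_line_scale[OF uv, of k]
    have "energy (\<lambda>r. D / b * (k * v r)) absolutely_integrable_on {0<..}"
      using vK by (simp only: k(2))
    note Zk = energy_hardy[OF uv' adm' this, unfolded k(2)]
    have zk: "z (\<lambda>r. k * u r) = (\<lambda>r. k * z u r)" by (auto simp: z_def)
    have "(\<integral>\<^sup>+r. ennreal (M (\<bar>z u r\<bar> / (D / b * K))) \<partial>weight_measure \<phi>)
        = (\<integral>\<^sup>+r. ennreal (energy (z (\<lambda>r. k * u r)) r) \<partial>lebesgue_on {0<..})"
      unfolding zk unfolding k_def by (rule nn_integral_weight_measure[OF mz]) (use b_pos D_ge_1 K in simp)
    also have "\<dots> \<le> (\<integral>\<^sup>+r. ennreal (energy (\<lambda>r. 1 / K * v r) r) \<partial>lebesgue_on {0<..})"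
      unfolding half_line_nn_integral(1)[OF energy_nonneg Zk(1)] half_line_nn_integral(1)[OF energy_nonneg vK]
      by (rule ennreal_leI[OF Zk(2)])
    also have "\<dots> \<le> 1" by (rule le1)
    finally have "ennreal (D / b * K) \<in> ?S (z u)"
      using mult_pos_pos[OF Db K(1)] by blast
    then have "luxemburg_norm M (weight_measure \<phi>) (z u) \<le> ennreal (D / b * K)"
      unfolding luxemburg_norm_def by (rule Inf_lower)
    also have "\<dots> \<le> ennreal (C * K)" using C K by (intro ennreal_leI mult_right_mono) auto
    also have "\<dots> = ennreal C * x" using C Db K by (simp add: ennreal_mult)
    finally show ?thesis .
  qed
  have C0: "0 < C" using C Db by simp
  have "luxemburg_norm M (weight_measure \<phi>) (z u) / ennreal C \<le> luxemburg_norm M (weight_measure \<phi>) v"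
    unfolding luxemburg_norm_def[of M _ v]
  proof (rule Inf_greatest)
    fix x assume "x \<in> ?S v"
    from bound[OF this] show "luxemburg_norm M (weight_measure \<phi>) (z u) / ennreal C \<le> x"
      using C0 by (simp add: divide_le_posI_ennreal mult.commute)
  qed
  then have "ennreal C * (luxemburg_norm M (weight_measure \<phi>) (z u) / ennreal C)
      \<le> ennreal C * luxemburg_norm M (weight_measure \<phi>) v"
    by (rule mult_left_mono) simp
  moreover have "ennreal C * (x / ennreal C) = x" for x
    using C0 ennreal_mult_divide_eq[of "ennreal C" x] by (simp add: ennreal_times_divide mult.commute)
  ultimately show ?thesis by simp
qed

lemma hardy_inequalities:
  assumes u: "u \<in> W11_loc" and v: "weak_derivative u v" and adm: "admissible u s R"
    and Db: "D / b \<le> l"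
  shows "(\<integral>\<^sup>+r. ennreal (M (\<bar>deriv \<phi> r\<bar> * \<bar>u r\<bar>) * exp (- \<phi> r)) \<partial>lebesgue_on {0<..})
      \<le> ennreal (c d D l) * (\<integral>\<^sup>+r. ennreal (M \<bar>v r\<bar> * exp (- \<phi> r)) \<partial>lebesgue_on {0<..})"
    and "luxemburg_norm M (weight_measure \<phi>) (\<lambda>r. deriv \<phi> r * u r)
      \<le> ennreal (c d D l + 1) * luxemburg_norm M (weight_measure \<phi>) v"
proof -
  note uv = W11_loc_primitive[OF u v]
  have pos: "0 < D / b" using b_pos D_ge_1 by simp
  have "ennreal (c d D (D / b)) \<le> ennreal (c d D l)"
    using Db pos by (intro ennreal_leI c_mono) auto
  then have "(\<integral>\<^sup>+r. ennreal (energy (z u) r) \<partial>lebesgue_on {0<..})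
      \<le> ennreal (c d D l) * (\<integral>\<^sup>+r. ennreal (energy v r) \<partial>lebesgue_on {0<..})"
    using modular_hardy[OF uv adm] by (meson mult_right_mono order.trans zero_le)
  then show "(\<integral>\<^sup>+r. ennreal (M (\<bar>deriv \<phi> r\<bar> * \<bar>u r\<bar>) * exp (- \<phi> r)) \<partial>lebesgue_on {0<..})
      \<le> ennreal (c d D l) * (\<integral>\<^sup>+r. ennreal (M \<bar>v r\<bar> * exp (- \<phi> r)) \<partial>lebesgue_on {0<..})"
    by (simp add: energy_def \<Phi>_def z_def abs_mult)
  have "D / b \<le> c d D l + 1" using Db pos c_ge[of l] by simp
  from luxemburg_hardy[OF uv adm this]
  show "luxemburg_norm M (weight_measure \<phi>) (\<lambda>r. deriv \<phi> r * u r)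
      \<le> ennreal (c d D l + 1) * luxemburg_norm M (weight_measure \<phi>) v"
    by (simp add: z_def[abs_def])
qed

lemma flux_eq_h: "flux u r = \<sigma> * (h \<phi> M u r * exp (- \<phi> r))"
  by (simp add: flux_def h_def z_def \<Phi>_def abs_mult)

lemma boundary_limit_admissible:
  assumes "boundary_limit \<phi> M u L" "0 \<le> ereal \<sigma> * L"
  shows "\<exists>s R. admissible u s R"
proof -
  obtain s R where pos: "\<forall>n. 0 < s n \<and> 0 < R n" and s: "s \<longlonglongrightarrow> 0"
    and R: "filterlim R at_top sequentially"
    and L: "(\<lambda>n. ereal (h \<phi> M u (R n) * exp (- \<phi> (R n)) - h \<phi> M u (s n) * exp (- \<phi> (s n)))) \<longlonglongrightarrow> L"
    using assms(1) unfolding boundary_limit_def by blast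
  have "(\<lambda>n. ereal \<sigma> * ereal (h \<phi> M u (R n) * exp (- \<phi> (R n)) - h \<phi> M u (s n) * exp (- \<phi> (s n))))
      \<longlonglongrightarrow> ereal \<sigma> * L"
    by (rule tendsto_cmult_ereal[OF _ L]) simp
  then have lim: "(\<lambda>n. ereal (flux u (R n) - flux u (s n))) \<longlonglongrightarrow> ereal \<sigma> * L"
    by (simp add: flux_eq_h right_diff_distrib)
  have "\<forall>\<^sub>F n in sequentially. flux u (s n) - \<eta> \<le> flux u (R n)" if "0 < \<eta>" for \<eta>
  proof -
    have "ereal (- \<eta>) < ereal \<sigma> * L"
      by (rule less_le_trans[OF _ assms(2)]) (use that in simp)
    from order_tendstoD(1)[OF lim this] show ?thesis by eventually_elim simp
  qed
  then show ?thesis using pos s R by (auto simp: admissible_def)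
qed

end

section \<open>The constants and the two cases\<close>

context growth_function begin

text \<open>The sign of \<open>\<phi>''\<close> decides which of the two bounds on \<open>t \<Phi>'(t)\<close> is the relevant one; this is the
  case distinction in the definition.\<close>

lemma b1_at_coercive:
  "b1_at \<phi> d D r * \<Phi> t \<le> \<Phi> t - curvature_ratio \<phi> r * (\<Phi>' t * t - \<Phi> t)"
proof (cases "deriv (deriv \<phi>) r \<le> 0")
  case True
  then have "curvature_ratio \<phi> r \<le> 0" by (simp add: curvature_ratio_def divide_nonpos_nonneg)
  then have "curvature_ratio \<phi> r * (\<Phi>' t * t) \<le> curvature_ratio \<phi> r * (d * \<Phi> t)"
    by (intro mult_left_mono_neg \<Phi>'_growth)
  then show ?thesis using True by (simp add: b1_at_def algebra_simps)
next
  case False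
  then have "0 \<le> curvature_ratio \<phi> r" by (simp add: curvature_ratio_def)
  then have "curvature_ratio \<phi> r * (\<Phi>' t * t) \<le> curvature_ratio \<phi> r * (D * \<Phi> t)"
    by (intro mult_left_mono \<Phi>'_growth)
  then show ?thesis using False by (simp add: b1_at_def algebra_simps)
qed

lemma b2_at_coercive:
  "b2_at \<phi> d D r * \<Phi> t \<le> - (\<Phi> t - curvature_ratio \<phi> r * (\<Phi>' t * t - \<Phi> t))"
proof (cases "deriv (deriv \<phi>) r \<le> 0")
  case True
  then have "curvature_ratio \<phi> r \<le> 0" by (simp add: curvature_ratio_def divide_nonpos_nonneg)
  then have "curvature_ratio \<phi> r * (D * \<Phi> t) \<le> curvature_ratio \<phi> r * (\<Phi>' t * t)"
    by (intro mult_left_mono_neg \<Phi>'_growth)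
  then show ?thesis using True by (simp add: b2_at_def algebra_simps)
next
  case False
  then have "0 \<le> curvature_ratio \<phi> r" by (simp add: curvature_ratio_def)
  then have "curvature_ratio \<phi> r * (d * \<Phi> t) \<le> curvature_ratio \<phi> r * (\<Phi>' t * t)"
    by (intro mult_left_mono \<Phi>'_growth)
  then show ?thesis using False by (simp add: b2_at_def algebra_simps)
qed

text \<open>A real number \<open>q\<close> strictly between the supremum and \<open>1 / (D - 1)\<close> yields a uniform positive lower
  bound of \<open>b1_at\<close>, so the infimum is positive and a genuine lower bound.\<close>

lemma b1_pos:
  assumes "(SUP r\<in>{0<..}. ereal (curvature_ratio \<phi> r)) < 1 / ereal (D - 1)"
  shows "0 < b1 \<phi> d D" and "\<And>r. 0 < r \<Longrightarrow> b1 \<phi> d D \<le> b1_at \<phi> d D r"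
proof -
  obtain q where q: "(SUP r\<in>{0<..}. ereal (curvature_ratio \<phi> r)) < ereal q" "ereal q < 1 / ereal (D - 1)"
    using ereal_dense2[OF assms] by blast
  have le: "curvature_ratio \<phi> r \<le> q" if "0 < r" for r
    using order.trans[OF SUP_upper[of r "{0<..}" "\<lambda>r. ereal (curvature_ratio \<phi> r)"] less_imp_le[OF q(1)]] that
    by simp
  define \<beta> where "\<beta> = min 1 (1 - (D - 1) * q)"
  have "(D - 1) * q < 1"
  proof (cases "D = 1")
    case False
    then have "0 < D - 1" using D_ge_1 by simp
    moreover from this have "q < 1 / (D - 1)" using q(2) by (simp add: one_ereal_def)
    ultimately show ?thesis by (simp add: field_simps)
  qed simp
  then have \<beta>: "0 < \<beta>" by (simp add: \<beta>_def)
  have at: "\<beta> \<le> b1_at \<phi> d D r" if r: "0 < r" for r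
  proof (cases "deriv (deriv \<phi>) r \<le> 0")
    case True
    then have "curvature_ratio \<phi> r \<le> 0" by (simp add: curvature_ratio_def divide_nonpos_nonneg)
    then have "0 \<le> (1 - d) * curvature_ratio \<phi> r" using d_ge_1 by (intro mult_nonpos_nonpos) auto
    then show ?thesis using True by (simp add: b1_at_def \<beta>_def)
  next
    case False
    have "(D - 1) * curvature_ratio \<phi> r \<le> (D - 1) * q"
      using le[OF r] D_ge_1 by (intro mult_left_mono) auto
    then show ?thesis using False by (simp add: b1_at_def \<beta>_def algebra_simps)
  qed
  have "\<beta> \<le> b1 \<phi> d D" unfolding b1_def by (rule cINF_greatest) (use at in auto)
  then show "0 < b1 \<phi> d D" using \<beta> by simp
  show "b1 \<phi> d D \<le> b1_at \<phi> d D r" if "0 < r" for r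
    unfolding b1_def by (rule cINF_lower) (use at that in \<open>auto intro!: bdd_belowI2[of _ \<beta>]\<close>)
qed

text \<open>For \<open>d = 1\<close> the hypothesis reads \<open>\<infinity> < \<dots>\<close> and cannot hold. Otherwise \<open>\<kappa> > 0\<close> on the
  half-line, and only one branch of \<open>b2_at\<close> occurs.\<close>

lemma b2_pos:
  assumes "1 / ereal (d - 1) < (INF r\<in>{0<..}. ereal (curvature_ratio \<phi> r))"
  shows "0 < b2 \<phi> d D" and "\<And>r. 0 < r \<Longrightarrow> b2 \<phi> d D \<le> b2_at \<phi> d D r"
proof -
  obtain q where q: "1 / ereal (d - 1) < ereal q" "ereal q < (INF r\<in>{0<..}. ereal (curvature_ratio \<phi> r))"
    using ereal_dense2[OF assms] by blast
  have ge: "q \<le> curvature_ratio \<phi> r" if "0 < r" for r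
    using order.trans[OF less_imp_le[OF q(2)] INF_lower[of r "{0<..}" "\<lambda>r. ereal (curvature_ratio \<phi> r)"]] that
    by simp
  have d: "1 < d" using q(1) d_ge_1 by (cases "d = 1") (auto simp: divide_ereal_def)
  then have "1 / (d - 1) < q" using q(1) by (simp add: one_ereal_def)
  moreover define \<beta> where "\<beta> = (d - 1) * q - 1"
  ultimately have \<beta>: "0 < \<beta>" using d by (simp add: field_simps)
  have q0: "0 < q" using \<open>1 / (d - 1) < q\<close> d by (smt (verit) divide_pos_pos)
  have at: "\<beta> \<le> b2_at \<phi> d D r" if r: "0 < r" for r
  proof -
    have "0 < curvature_ratio \<phi> r" using ge[OF r] q0 by simp
    then have "\<not> deriv (deriv \<phi>) r \<le> 0"
      by (auto simp: curvature_ratio_def zero_less_divide_iff)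
    moreover have "(d - 1) * q \<le> (d - 1) * curvature_ratio \<phi> r"
      using ge[OF r] d by (intro mult_left_mono) auto
    ultimately show ?thesis by (simp add: b2_at_def \<beta>_def)
  qed
  have "\<beta> \<le> b2 \<phi> d D" unfolding b2_def by (rule cINF_greatest) (use at in auto)
  then show "0 < b2 \<phi> d D" using \<beta> by simp
  show "b2 \<phi> d D \<le> b2_at \<phi> d D r" if "0 < r" for r
    unfolding b2_def by (rule cINF_lower) (use at that in \<open>auto intro!: bdd_belowI2[of _ \<beta>]\<close>)
qed

lemma constant_le: "0 < b \<Longrightarrow> D / b \<le> D\<^sup>2 / (b * d)"
proof -
  assume b: "0 < b"
  have "D / b * 1 \<le> D / b * (D / d)"
    using b D_ge_1 d_ge_1 d_le_D by (intro mult_left_mono) auto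
  then show ?thesis by (simp add: power2_eq_square)
qed

end

theorem corollary3p1:
  fixes M \<phi> :: "real \<Rightarrow> real" and d D :: real
  assumes "N_function M"
    and "M differentiable_on {0..}"
    and "1 \<le> d" and "d \<le> D"
    and "\<And>x. x > 0 \<Longrightarrow> d * (M x / x) \<le> deriv M x \<and> deriv M x \<le> D * (M x / x)"
    and "\<And>r. r > 0 \<Longrightarrow> \<phi> differentiable (at r)"
    and "\<And>r. r > 0 \<Longrightarrow> deriv \<phi> differentiable (at r)"
    and "continuous_on {0<..} (deriv (deriv \<phi>))"
    and "\<And>r. r > 0 \<Longrightarrow> deriv \<phi> r \<noteq> 0"
  shows
    "((SUP r\<in>{0<..}. ereal (curvature_ratio \<phi> r)) < 1 / ereal (D - 1) \<longrightarrow>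
       (\<forall>u\<in>R_plus \<phi> M. \<forall>u'. weak_derivative u u' \<longrightarrow>
          (\<integral>\<^sup>+r. ennreal (M (\<bar>deriv \<phi> r\<bar> * \<bar>u r\<bar>) * exp (- \<phi> r)) \<partial>lebesgue_on {0<..})
            \<le> ennreal (c d D (D\<^sup>2 / (b1 \<phi> d D * d))) *
              (\<integral>\<^sup>+r. ennreal (M \<bar>u' r\<bar> * exp (- \<phi> r)) \<partial>lebesgue_on {0<..}) \<and>
          luxemburg_norm M (weight_measure \<phi>) (\<lambda>r. deriv \<phi> r * u r)
            \<le> ennreal (c d D (D\<^sup>2 / (b1 \<phi> d D * d)) + 1) *
              luxemburg_norm M (weight_measure \<phi>) u')) \<and>
     ((INF r\<in>{0<..}. ereal (curvature_ratio \<phi> r)) > 1 / ereal (d - 1) \<longrightarrow>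
       (\<forall>u\<in>R_minus \<phi> M. \<forall>u'. weak_derivative u u' \<longrightarrow>
          (\<integral>\<^sup>+r. ennreal (M (\<bar>deriv \<phi> r\<bar> * \<bar>u r\<bar>) * exp (- \<phi> r)) \<partial>lebesgue_on {0<..})
            \<le> ennreal (c d D (D\<^sup>2 / (b2 \<phi> d D * d))) *
              (\<integral>\<^sup>+r. ennreal (M \<bar>u' r\<bar> * exp (- \<phi> r)) \<partial>lebesgue_on {0<..}) \<and>
          luxemburg_norm M (weight_measure \<phi>) (\<lambda>r. deriv \<phi> r * u r)
            \<le> ennreal (c d D (D\<^sup>2 / (b2 \<phi> d D * d)) + 1) *
              luxemburg_norm M (weight_measure \<phi>) u'))"
proof (intro conjI impI ballI)
  interpret growth_function M d D
    by unfold_locales (use assms in auto)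
  {
    assume sup: "(SUP r\<in>{0<..}. ereal (curvature_ratio \<phi> r)) < 1 / ereal (D - 1)"
    fix u assume u: "u \<in> R_plus \<phi> M"
    interpret hardy_flux M d D \<phi> 1 "b1 \<phi> d D"
    proof unfold_locales
      fix r t :: real assume r: "0 < r"
      show "b1 \<phi> d D * \<Phi> t \<le> 1 * (\<Phi> t - curvature_ratio \<phi> r * (\<Phi>' t * t - \<Phi> t))"
        using order.trans[OF mult_right_mono[OF b1_pos(2)[OF sup r] \<Phi>_nonneg] b1_at_coercive] by simp
    qed (use assms b1_pos(1)[OF sup] in auto)
    obtain L where L: "0 \<le> L" "boundary_limit \<phi> M u L" using u by (auto simp: R_plus_def)
    have "0 \<le> ereal 1 * L" using L(1) by (simp flip: one_ereal_def)
    then obtain s R where adm: "admissible u s R"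
      using boundary_limit_admissible[OF L(2)] by blast
    have "u \<in> W11_loc" using u by (simp add: R_plus_def)
    note hardy = hardy_inequalities[OF this _ adm constant_le[OF b_pos]]
    show "\<forall>u'. weak_derivative u u' \<longrightarrow>
          (\<integral>\<^sup>+r. ennreal (M (\<bar>deriv \<phi> r\<bar> * \<bar>u r\<bar>) * exp (- \<phi> r)) \<partial>lebesgue_on {0<..})
            \<le> ennreal (c d D (D\<^sup>2 / (b1 \<phi> d D * d))) *
              (\<integral>\<^sup>+r. ennreal (M \<bar>u' r\<bar> * exp (- \<phi> r)) \<partial>lebesgue_on {0<..}) \<and>
          luxemburg_norm M (weight_measure \<phi>) (\<lambda>r. deriv \<phi> r * u r)
            \<le> ennreal (c d D (D\<^sup>2 / (b1 \<phi> d D * d)) + 1) *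
              luxemburg_norm M (weight_measure \<phi>) u'"
      using hardy by blast
  next
    assume inf: "1 / ereal (d - 1) < (INF r\<in>{0<..}. ereal (curvature_ratio \<phi> r))"
    fix u assume u: "u \<in> R_minus \<phi> M"
    interpret hardy_flux M d D \<phi> "- 1" "b2 \<phi> d D"
    proof unfold_locales
      fix r t :: real assume r: "0 < r"
      show "b2 \<phi> d D * \<Phi> t \<le> - 1 * (\<Phi> t - curvature_ratio \<phi> r * (\<Phi>' t * t - \<Phi> t))"
        using order.trans[OF mult_right_mono[OF b2_pos(2)[OF inf r] \<Phi>_nonneg] b2_at_coercive] by simp
    qed (use assms b2_pos(1)[OF inf] in auto)
    obtain L where L: "L \<le> 0" "boundary_limit \<phi> M u L" using u by (auto simp: R_minus_def)
    have "0 \<le> ereal (- 1) * L" using L(1) by (cases L) auto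
    then obtain s R where adm: "admissible u s R"
      using boundary_limit_admissible[OF L(2)] by blast
    have "u \<in> W11_loc" using u by (simp add: R_minus_def)
    note hardy = hardy_inequalities[OF this _ adm constant_le[OF b_pos]]
    show "\<forall>u'. weak_derivative u u' \<longrightarrow>
          (\<integral>\<^sup>+r. ennreal (M (\<bar>deriv \<phi> r\<bar> * \<bar>u r\<bar>) * exp (- \<phi> r)) \<partial>lebesgue_on {0<..})
            \<le> ennreal (c d D (D\<^sup>2 / (b2 \<phi> d D * d))) *
              (\<integral>\<^sup>+r. ennreal (M \<bar>u' r\<bar> * exp (- \<phi> r)) \<partial>lebesgue_on {0<..}) \<and>
          luxemburg_norm M (weight_measure \<phi>) (\<lambda>r. deriv \<phi> r * u r)
            \<le> ennreal (c d D (D\<^sup>2 / (b2 \<phi> d D * d)) + 1) *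
              luxemburg_norm M (weight_measure \<phi>) u'"
      using hardy by blast
  }
qed

end
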